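(* Every irreducible component of the variety $\mathfrak{Leib}_4$ of four-dimensional complex Leibniz algebra structures contains a (structure representing a) non-nilpotent algebra.
   Context: All vector spaces and algebras are over $\mathbb{C}$. An algebra is a vector space with a bilinear multiplication; it is a Leibniz algebra if $(xy)z=(xz)y+x(yz)$ for all $x,y,z$. Let $V$ be a vector space of dimension $n$ with fixed basis $e_1,\dots,e_n$. The space $\mathrm{Hom}(V\otimes V,V)$ is identified with the affine space $\mathbb{C}^{n^3}$ via structure constants $c_{i,j}^k$, where $\mu(e_i\otimes e_j)=\sum_k c_{i,j}^k e_k$, and carries the Zariski topology. $\mathfrak{Leib}_n\subset \mathrm{Hom}(V\otimes V,V)$ is the Zariski closed subset of structures satisfying the Leibniz identity. An irreducible component is a maximal irreducible closed subset of $\mathfrak{Leib}_n$. *)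

theory Defs
  imports "HOL-Analysis.Analysis"
begin

text \<open>
  An algebra structure on the vector space with basis \<open>axis i 1\<close> is given by its structure
  constants: \<open>c $ i $ j $ k\<close> is the coefficient of \<open>e\<^sub>k\<close> in \<open>e\<^sub>i e\<^sub>j\<close>.
\<close>

type_synonym 'n structure_constants = "complex ^ 'n ^ 'n ^ 'n"

definition alg_mult ::
  "'n structure_constants \<Rightarrow> complex ^ 'n \<Rightarrow> complex ^ 'n \<Rightarrow> complex ^ 'n::finite" where
  "alg_mult c x y = (\<chi> k. \<Sum>i\<in>UNIV. \<Sum>j\<in>UNIV. x $ i * y $ j * c $ i $ j $ k)"

lemma alg_mult_axis: "alg_mult c (axis i 1) (axis j 1) = c $ i $ j"
proof -
  have "(\<Sum>b\<in>UNIV. axis i 1 $ a * axis j 1 $ b * c $ a $ b $ k) =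
      (if a = i then c $ a $ j $ k else 0)" for a k
    by (simp add: axis_def if_distrib[of "\<lambda>t. t * _"] cong: if_cong)
  then show ?thesis
    by (simp add: alg_mult_def vec_eq_iff)
qed

definition Leib :: "'n::finite structure_constants set" where
  "Leib = {c. \<forall>x y z. alg_mult c (alg_mult c x y) z =
                alg_mult c (alg_mult c x z) y + alg_mult c x (alg_mult c y z)}"

text \<open>
  Lower central series \<open>L\<^sup>1 = L\<close>, \<open>L\<^sup>k\<^sup>+\<^sup>1 = L\<^sup>k L\<close> (with index shifted by one).
  For the Leibniz identity above, \<open>L\<^sup>i L\<^sup>j \<subseteq> L\<^sup>i\<^sup>+\<^sup>j\<close>, so this agrees with the
  nilpotency of nonassociative algebras defined through all bracketings.
  Note that \<open>vec.span\<close> is the complex span, whereas \<open>span\<close> would be the real one.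
\<close>

primrec lower_central :: "'n::finite structure_constants \<Rightarrow> nat \<Rightarrow> (complex ^ 'n) set" where
  "lower_central c 0 = UNIV"
| "lower_central c (Suc m) = vec.span {alg_mult c x y | x y. x \<in> lower_central c m}"

definition nilpotent_algebra :: "'n::finite structure_constants \<Rightarrow> bool" where
  "nilpotent_algebra c \<longleftrightarrow> (\<exists>m. lower_central c m = {0})"

inductive polynomial_fun :: "('n::finite structure_constants \<Rightarrow> complex) \<Rightarrow> bool" where
  const: "polynomial_fun (\<lambda>c. a)"
| coord: "polynomial_fun (\<lambda>c. c $ i $ j $ k)"
| add: "polynomial_fun p \<Longrightarrow> polynomial_fun q \<Longrightarrow> polynomial_fun (\<lambda>c. p c + q c)"
| mult: "polynomial_fun p \<Longrightarrow> polynomial_fun q \<Longrightarrow> polynomial_fun (\<lambda>c. p c * q c)"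

definition zero_locus ::
  "('n::finite structure_constants \<Rightarrow> complex) set \<Rightarrow> 'n structure_constants set" where
  "zero_locus P = {c. \<forall>p\<in>P. p c = 0}"

definition algebraic_set :: "'n::finite structure_constants set \<Rightarrow> bool" where
  "algebraic_set S \<longleftrightarrow> (\<exists>P. (\<forall>p\<in>P. polynomial_fun p) \<and> S = zero_locus P)"

definition zariski :: "'n::finite structure_constants topology" where
  "zariski = topology (\<lambda>U. algebraic_set (- U))"

lemma algebraic_set_empty: "algebraic_set {}"
  unfolding algebraic_set_def zero_locus_def
  by (rule exI[of _ "{\<lambda>c. 1}"]) (auto intro: polynomial_fun.const)

lemma algebraic_set_Un:
  assumes "algebraic_set S" "algebraic_set T"
  shows "algebraic_set (S \<union> T)"
proof -
  obtain P Q where P: "\<forall>p\<in>P. polynomial_fun p" "S = zero_locus P"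
    and Q: "\<forall>q\<in>Q. polynomial_fun q" "T = zero_locus Q"
    using assms unfolding algebraic_set_def by blast
  let ?R = "(\<lambda>(p, q) c. p c * q c) ` (P \<times> Q)"
  have "\<forall>r\<in>?R. polynomial_fun r"
    using P(1) Q(1) by (auto intro: polynomial_fun.mult)
  moreover have "S \<union> T = zero_locus ?R"
    unfolding P(2) Q(2) zero_locus_def by auto
  ultimately show ?thesis
    unfolding algebraic_set_def by (intro exI[of _ ?R] conjI)
qed

lemma algebraic_set_Inter:
  assumes "\<And>S. S \<in> \<S> \<Longrightarrow> algebraic_set S"
  shows "algebraic_set (\<Inter>\<S>)"
proof -
  let ?R = "{p. polynomial_fun p \<and> (\<exists>S\<in>\<S>. \<forall>c\<in>S. p c = 0)}"
  have "S = zero_locus {p. polynomial_fun p \<and> (\<forall>c\<in>S. p c = 0)}" if S: "S \<in> \<S>" for S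
  proof -
    obtain P where "\<forall>p\<in>P. polynomial_fun p" "S = {c. \<forall>p\<in>P. p c = 0}"
      using assms[OF S] unfolding algebraic_set_def zero_locus_def by auto
    then show ?thesis
      unfolding zero_locus_def by auto
  qed
  then have "c \<in> S" if "c \<in> zero_locus ?R" "S \<in> \<S>" for c S
    using that unfolding zero_locus_def by fast
  then have "\<Inter>\<S> = zero_locus ?R"
    unfolding zero_locus_def by auto
  moreover have "\<forall>p\<in>?R. polynomial_fun p"
    by simp
  ultimately show ?thesis
    unfolding algebraic_set_def by (intro exI[of _ ?R] conjI)
qed

lemma istopology_zariski: "istopology (\<lambda>U. algebraic_set (- U))"
proof -
  have "algebraic_set (- \<Union>\<U>)" if "\<forall>U\<in>\<U>. algebraic_set (- U)"
    for \<U> :: "'a structure_constants set set"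
  proof -
    have "algebraic_set (\<Inter>(uminus ` \<U>))"
      using that by (intro algebraic_set_Inter) blast
    moreover have "\<Inter>(uminus ` \<U>) = - \<Union>\<U>"
      by blast
    ultimately show ?thesis
      by simp
  qed
  then show ?thesis
    unfolding istopology_def Compl_Int by (blast intro: algebraic_set_Un)
qed

lemma openin_zariski: "openin zariski U \<longleftrightarrow> algebraic_set (- U)"
  unfolding zariski_def by (simp add: topology_inverse'[OF istopology_zariski])

lemma topspace_zariski: "topspace zariski = UNIV"
proof -
  have "openin zariski (UNIV :: 'a structure_constants set)"
    by (simp add: openin_zariski algebraic_set_empty)
  then show ?thesis
    using openin_subset by (metis top.extremum_uniqueI)
qed

lemma closedin_zariski: "closedin zariski S \<longleftrightarrow> algebraic_set S"
  by (simp add: closedin_def openin_zariski topspace_zariski Compl_eq_Diff_UNIV[symmetric])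

lemma polynomial_fun_sum:
  "(\<And>i. i \<in> I \<Longrightarrow> polynomial_fun (f i)) \<Longrightarrow> polynomial_fun (\<lambda>c. \<Sum>i\<in>I. f i c)"
  by (induction I rule: infinite_finite_induct) (auto intro: polynomial_fun.intros)

lemma polynomial_fun_alg_mult:
  assumes "\<And>i. polynomial_fun (\<lambda>c. f c $ i)" "\<And>i. polynomial_fun (\<lambda>c. g c $ i)"
  shows "polynomial_fun (\<lambda>c. alg_mult c (f c) (g c) $ k)"
  unfolding alg_mult_def vec_lambda_beta
  by (intro polynomial_fun_sum polynomial_fun.mult polynomial_fun.coord assms)

lemma closedin_zariski_Leib: "closedin zariski (Leib :: 'n::finite structure_constants set)"
proof -
  define p where "p x y z k c = alg_mult c (alg_mult c x y) z $ k +
      (-1) * (alg_mult c (alg_mult c x z) y $ k + alg_mult c x (alg_mult c y z) $ k)"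
    for x y z k and c :: "'n structure_constants"
  have "polynomial_fun (p x y z k)" for x y z k
    unfolding p_def[abs_def]
    by (intro polynomial_fun.add polynomial_fun.mult polynomial_fun.const polynomial_fun_alg_mult)
  moreover have "c \<in> Leib \<longleftrightarrow> (\<forall>x y z k. p x y z k c = 0)" for c
  proof -
    have "a + (-1) * b = 0 \<longleftrightarrow> a = b" for a b :: complex
      by simp
    then show ?thesis
      unfolding Leib_def p_def by (simp only: mem_Collect_eq vec_eq_iff vector_add_component)
  qed
  then have "Leib = zero_locus (range (\<lambda>(x, y, z, k). p x y z k))"
    unfolding zero_locus_def by auto
  ultimately show ?thesis
    unfolding closedin_zariski algebraic_set_def
    by (intro exI[of _ "range (\<lambda>(x, y, z, k). p x y z k)"]) auto
qed

definition irreducible_in :: "'a topology \<Rightarrow> 'a set \<Rightarrow> bool" where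
  "irreducible_in X S \<longleftrightarrow> S \<subseteq> topspace X \<and> S \<noteq> {} \<and>
     (\<forall>A B. closedin X A \<and> closedin X B \<and> S \<subseteq> A \<union> B \<longrightarrow> S \<subseteq> A \<or> S \<subseteq> B)"

definition irreducible_component_of :: "'a topology \<Rightarrow> 'a set \<Rightarrow> bool" where
  "irreducible_component_of X C \<longleftrightarrow> closedin X C \<and> irreducible_in X C \<and>
     (\<forall>D. closedin X D \<and> irreducible_in X D \<and> C \<subseteq> D \<longrightarrow> D = C)"

end

theory Submission
  imports Defs "HOL-Computational_Algebra.Polynomial"
begin

text \<open>
  Every nilpotent four-dimensional Leibniz algebra lies in one of five families of Leibniz
  algebras, each of which depends polynomially on parameters (up to a change of basis) and also
  contains a non-nilpotent algebra. Such a family is irreducible, since two of its members are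
  joined by a rational curve inside it. A component consisting of nilpotent algebras is covered by
  the closures of the five families, hence contained in one of them and, by maximality, equal to
  it: a contradiction.

  The families deform the nilpotent algebras with \<open>dim L\<^sup>2 = 3\<close>, with \<open>dim L\<^sup>2 \<le> 1\<close>, with
  \<open>dim L\<^sup>2 = 2\<close> and \<open>L\<^sup>3 = 0\<close>, and with \<open>L\<^sup>2 = \<langle>v, u\<rangle>\<close> and \<open>L\<^sup>3 = \<langle>u\<rangle>\<close>. In the last case
  \<open>v x = f(x) u\<close>, \<open>x v = g(x) u\<close>, and the Leibniz identity forces \<open>g = 0\<close> or \<open>g = - f\<close>; this
  accounts for two families.
\<close>

subsection \<open>Change of basis\<close>

lemma alg_mult_add_left: "alg_mult c (x + x') y = alg_mult c x y + alg_mult c x' y"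
  by (simp add: alg_mult_def vec_eq_iff algebra_simps sum.distrib)

lemma alg_mult_add_right: "alg_mult c x (y + y') = alg_mult c x y + alg_mult c x y'"
  by (simp add: alg_mult_def vec_eq_iff algebra_simps sum.distrib)

lemma alg_mult_scale_left: "alg_mult c (a *s x) y = a *s alg_mult c x y"
  by (simp add: alg_mult_def vec_eq_iff sum_distrib_left mult_ac)

lemma alg_mult_scale_right: "alg_mult c x (a *s y) = a *s alg_mult c x y"
  by (simp add: alg_mult_def vec_eq_iff sum_distrib_left mult_ac)

lemma alg_mult_zero_left [simp]: "alg_mult c 0 y = 0"
  by (simp add: alg_mult_def vec_eq_iff)

lemma alg_mult_zero_right [simp]: "alg_mult c x 0 = 0"
  by (simp add: alg_mult_def vec_eq_iff)

definition bilinear_mult :: "(complex ^ 'n \<Rightarrow> complex ^ 'n \<Rightarrow> complex ^ 'n) \<Rightarrow> bool" where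
  "bilinear_mult m \<longleftrightarrow>
    (\<forall>x x' y. m (x + x') y = m x y + m x' y) \<and> (\<forall>a x y. m (a *s x) y = a *s m x y) \<and>
    (\<forall>x y y'. m x (y + y') = m x y + m x y') \<and> (\<forall>a x y. m x (a *s y) = a *s m x y)"

lemma bilinear_mult_alg_mult: "bilinear_mult (alg_mult c)"
  by (simp add: bilinear_mult_def alg_mult_add_left alg_mult_add_right
      alg_mult_scale_left alg_mult_scale_right)

text \<open>Inverse to \<open>alg_mult\<close> on bilinear maps, so that algebras can be given by
  products of vectors instead of arrays.\<close>

definition structure_of ::
  "(complex ^ 'n \<Rightarrow> complex ^ 'n \<Rightarrow> complex ^ 'n) \<Rightarrow> 'n::finite structure_constants" where
  "structure_of m = (\<chi> i j. m (axis i 1) (axis j 1))"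

lemma bilinear_mult_expand:
  fixes m :: "complex ^ 'n \<Rightarrow> complex ^ 'n \<Rightarrow> complex ^ 'n::finite"
  assumes "bilinear_mult m"
  shows "m x y = (\<Sum>i\<in>UNIV. \<Sum>j\<in>UNIV. (x $ i * y $ j) *s m (axis i 1) (axis j 1))"
proof -
  have m0: "m 0 y = 0" "m y 0 = 0" for y
  proof -
    have "m (0 *s 0) y = 0 *s m 0 y" "m y (0 *s 0) = 0 *s m y 0"
      using assms unfolding bilinear_mult_def by blast+
    then show "m 0 y = 0" "m y 0 = 0"
      by simp_all
  qed
  have L: "m (\<Sum>i\<in>I. f i) y = (\<Sum>i\<in>I. m (f i) y)" for I and f :: "'n \<Rightarrow> _" and y
    using assms unfolding bilinear_mult_def
    by (induction I rule: infinite_finite_induct) (auto simp: m0)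
  have R: "m x (\<Sum>i\<in>I. f i) = (\<Sum>i\<in>I. m x (f i))" for I and f :: "'n \<Rightarrow> _" and x
    using assms unfolding bilinear_mult_def
    by (induction I rule: infinite_finite_induct) (auto simp: m0)
  have "m x y = m (\<Sum>i\<in>UNIV. x $ i *s axis i 1) (\<Sum>j\<in>UNIV. y $ j *s axis j 1)"
    by (simp add: basis_expansion)
  also have "\<dots> = (\<Sum>i\<in>UNIV. \<Sum>j\<in>UNIV. (x $ i * y $ j) *s m (axis i 1) (axis j 1))"
    using assms unfolding bilinear_mult_def L
    by (simp add: R vector_smult_assoc vec.scale_sum_right mult_ac)
  finally show ?thesis .
qed

lemma bilinear_mult_eqI:
  fixes m m' :: "complex ^ 'n \<Rightarrow> complex ^ 'n \<Rightarrow> complex ^ 'n::finite"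
  assumes "bilinear_mult m" "bilinear_mult m'"
    and "\<And>i j. m (axis i 1) (axis j 1) = m' (axis i 1) (axis j 1)"
  shows "m = m'"
proof (intro ext)
  fix x y
  show "m x y = m' x y"
    unfolding bilinear_mult_expand[OF assms(1), of x y] bilinear_mult_expand[OF assms(2), of x y]
    by (simp only: assms(3))
qed

lemma alg_mult_structure_of: "bilinear_mult m \<Longrightarrow> alg_mult (structure_of m) = m"
  by (intro bilinear_mult_eqI bilinear_mult_alg_mult)
    (simp_all add: alg_mult_axis structure_of_def)

lemma structure_of_alg_mult [simp]: "structure_of (alg_mult c) = c"
  by (simp add: structure_of_def alg_mult_axis vec_eq_iff)

definition transport ::
  "complex ^ 'n ^ 'n \<Rightarrow> 'n structure_constants \<Rightarrow> 'n::finite structure_constants" where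
  "transport g c = structure_of (\<lambda>x y. g *v alg_mult c (matrix_inv g *v x) (matrix_inv g *v y))"

lemma alg_mult_transport:
  "alg_mult (transport g c) x y = g *v alg_mult c (matrix_inv g *v x) (matrix_inv g *v y)"
proof -
  have "bilinear_mult (\<lambda>x y. g *v alg_mult c (matrix_inv g *v x) (matrix_inv g *v y))"
    unfolding bilinear_mult_def
    by (simp only: matrix_vector_right_distrib vector_scalar_commute
      alg_mult_add_left alg_mult_add_right alg_mult_scale_left alg_mult_scale_right simp_thms)
  then show ?thesis
    by (simp only: transport_def alg_mult_structure_of)
qed

lemma matrix_inv_mult_vector:
  fixes g :: "complex ^ 'n ^ 'n"
  assumes "det g \<noteq> 0"
  shows "matrix_inv g *v (g *v x) = x" "g *v (matrix_inv g *v x) = x"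
proof -
  have "\<exists>h. g ** h = mat 1 \<and> h ** g = mat 1"
    using assms by (simp add: invertible_det_nz flip: invertible_def)
  then have "g ** matrix_inv g = mat 1 \<and> matrix_inv g ** g = mat 1"
    unfolding matrix_inv_def by (rule someI_ex)
  then show "matrix_inv g *v (g *v x) = x" "g *v (matrix_inv g *v x) = x"
    by (simp_all add: matrix_vector_mul_assoc)
qed

lemma transport_mat_1 [simp]: "transport (mat 1) c = c"
proof -
  have "alg_mult (transport (mat 1) c) = alg_mult c"
    using matrix_inv_mult_vector(1)[of "mat 1 :: complex ^ 'a ^ 'a"]
    by (intro ext) (simp add: alg_mult_transport)
  then show ?thesis
    by (metis structure_of_alg_mult)
qed

text \<open>Avoids \<open>matrix_inv\<close>: it suffices that the columns of \<open>g\<close>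
  multiply in \<open>c\<close> with structure constants \<open>p\<close>.\<close>

lemma transport_eqI:
  assumes "det g \<noteq> 0"
    and "\<And>i j. alg_mult c (g *v axis i 1) (g *v axis j 1) = g *v (p $ i $ j)"
  shows "transport g p = c"
proof -
  have eq: "(\<lambda>x y. alg_mult c (g *v x) (g *v y)) = (\<lambda>x y. g *v alg_mult p x y)"
    by (rule bilinear_mult_eqI)
      (simp_all only: bilinear_mult_def matrix_vector_right_distrib vector_scalar_commute
      alg_mult_add_left alg_mult_add_right alg_mult_scale_left alg_mult_scale_right
      alg_mult_axis assms(2) simp_thms)
  have "g *v alg_mult p x y = alg_mult c (g *v x) (g *v y)" for x y
    using fun_cong[OF fun_cong[OF eq, of x], of y] by simp
  then have "alg_mult (transport g p) = alg_mult c"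
    by (intro ext) (simp add: alg_mult_transport matrix_inv_mult_vector(2)[OF assms(1)])
  then show ?thesis
    by (metis structure_of_alg_mult)
qed

lemma transport_Leib:
  assumes "det g \<noteq> 0" "p \<in> Leib"
  shows "transport g p \<in> Leib"
proof -
  have eq: "alg_mult p (alg_mult p x y) z =
      alg_mult p (alg_mult p x z) y + alg_mult p x (alg_mult p y z)" for x y z
    using assms(2) unfolding Leib_def by blast
  show ?thesis
    unfolding Leib_def mem_Collect_eq alg_mult_transport matrix_inv_mult_vector[OF assms(1)]
    by (subst eq) (simp only: matrix_vector_right_distrib simp_thms)
qed

subsection \<open>Irreducibility of polynomial families\<close>

definition polynomial_curve :: "(complex \<Rightarrow> complex) \<Rightarrow> bool" where
  "polynomial_curve f \<longleftrightarrow> (\<exists>P. f = poly P)"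

lemma polynomial_curve_intros:
  "polynomial_curve (\<lambda>t. a)" "polynomial_curve (\<lambda>t. t)"
  "polynomial_curve f \<Longrightarrow> polynomial_curve g \<Longrightarrow> polynomial_curve (\<lambda>t. f t + g t)"
  "polynomial_curve f \<Longrightarrow> polynomial_curve g \<Longrightarrow> polynomial_curve (\<lambda>t. f t * g t)"
  "(\<And>i. i \<in> I \<Longrightarrow> polynomial_curve (h i)) \<Longrightarrow> polynomial_curve (\<lambda>t. \<Sum>i\<in>I. h i t)"
  "(\<And>i. i \<in> I \<Longrightarrow> polynomial_curve (h i)) \<Longrightarrow> polynomial_curve (\<lambda>t. \<Prod>i\<in>I. h i t)"
proof -
  show const: "polynomial_curve (\<lambda>t. a)" for a
    unfolding polynomial_curve_def by (intro exI[of _ "[:a:]"]) auto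
  show "polynomial_curve (\<lambda>t. t)"
    unfolding polynomial_curve_def by (intro exI[of _ "[:0, 1:]"]) auto
  show add: "polynomial_curve (\<lambda>t. f t + g t)"
    if fg: "polynomial_curve f" "polynomial_curve g" for f g
  proof -
    from fg obtain P Q where "f = poly P" "g = poly Q"
      unfolding polynomial_curve_def by auto
    then show ?thesis
      unfolding polynomial_curve_def by (intro exI[of _ "P + Q"]) auto
  qed
  show mult: "polynomial_curve (\<lambda>t. f t * g t)"
    if fg: "polynomial_curve f" "polynomial_curve g" for f g
  proof -
    from fg obtain P Q where "f = poly P" "g = poly Q"
      unfolding polynomial_curve_def by auto
    then show ?thesis
      unfolding polynomial_curve_def by (intro exI[of _ "P * Q"]) auto
  qed
  show "polynomial_curve (\<lambda>t. \<Sum>i\<in>I. h i t)" if "\<And>i. i \<in> I \<Longrightarrow> polynomial_curve (h i)"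
    using that by (induction I rule: infinite_finite_induct) (auto intro: const add)
  show "polynomial_curve (\<lambda>t. \<Prod>i\<in>I. h i t)" if "\<And>i. i \<in> I \<Longrightarrow> polynomial_curve (h i)"
    using that by (induction I rule: infinite_finite_induct) (auto intro: const mult)
qed

lemma polynomial_curve_det:
  assumes "\<And>i j. polynomial_curve (\<lambda>t. g t $ i $ j)"
  shows "polynomial_curve (\<lambda>t. det (g t))"
  unfolding det_def by (intro polynomial_curve_intros assms)

definition affine_line :: "'n::finite structure_constants \<Rightarrow> 'n structure_constants \<Rightarrow> complex \<Rightarrow>
    'n structure_constants" where
  "affine_line p q t = (\<chi> i j k. p $ i $ j $ k + t * (q $ i $ j $ k - p $ i $ j $ k))"

lemma affine_line_ends [simp]: "affine_line p q 0 = p" "affine_line p q 1 = q"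
  by (simp_all add: affine_line_def vec_eq_iff)

lemma polynomial_curve_affine_line:
  "polynomial_fun F \<Longrightarrow> polynomial_curve (\<lambda>t. F (affine_line p q t))"
  by (induction rule: polynomial_fun.induct)
    (auto simp: affine_line_def intro!: polynomial_curve_intros)

text \<open>The denominators are powers of a single \<open>d\<close>. Zeros of \<open>d\<close> are
  exempt: in the application \<open>d\<close> is \<open>det (g t)\<close>, and there
  \<open>g t\<close> has no inverse.\<close>

definition rational_curve :: "(complex \<Rightarrow> complex) \<Rightarrow> (complex \<Rightarrow> complex) \<Rightarrow> bool" where
  "rational_curve d f \<longleftrightarrow> (\<exists>n P. polynomial_curve P \<and> (\<forall>t. d t \<noteq> 0 \<longrightarrow> f t = P t / d t ^ n))"

lemma rational_curve_polynomial: "polynomial_curve P \<Longrightarrow> rational_curve d P"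
  unfolding rational_curve_def by (intro exI[of _ 0] exI[of _ P]) auto

lemma rational_curve_divide: "polynomial_curve P \<Longrightarrow> rational_curve d (\<lambda>t. P t / d t)"
  unfolding rational_curve_def by (intro exI[of _ 1] exI[of _ P]) auto

lemma rational_curve_mult:
  assumes "rational_curve d f" "rational_curve d g"
  shows "rational_curve d (\<lambda>t. f t * g t)"
proof -
  obtain m n P Q where "polynomial_curve P" "\<forall>t. d t \<noteq> 0 \<longrightarrow> f t = P t / d t ^ m"
    "polynomial_curve Q" "\<forall>t. d t \<noteq> 0 \<longrightarrow> g t = Q t / d t ^ n"
    using assms unfolding rational_curve_def by metis
  then show ?thesis
    unfolding rational_curve_def
    by (intro exI[of _ "m + n"] exI[of _ "\<lambda>t. P t * Q t"])
      (auto simp: power_add intro: polynomial_curve_intros)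
qed

lemma polynomial_curve_power: "polynomial_curve d \<Longrightarrow> polynomial_curve (\<lambda>t. d t ^ n)"
  by (induction n) (auto intro: polynomial_curve_intros)

lemma rational_curve_add:
  assumes "polynomial_curve d" "rational_curve d f" "rational_curve d g"
  shows "rational_curve d (\<lambda>t. f t + g t)"
proof -
  obtain m n P Q where PQ: "polynomial_curve P" "\<forall>t. d t \<noteq> 0 \<longrightarrow> f t = P t / d t ^ m"
    "polynomial_curve Q" "\<forall>t. d t \<noteq> 0 \<longrightarrow> g t = Q t / d t ^ n"
    using assms unfolding rational_curve_def by metis
  have "polynomial_curve (\<lambda>t. P t * d t ^ n + Q t * d t ^ m)"
    using assms PQ by (intro polynomial_curve_intros polynomial_curve_power)
  moreover have "f t + g t = (P t * d t ^ n + Q t * d t ^ m) / d t ^ (m + n)" if "d t \<noteq> 0" for t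
    using that PQ by (simp add: power_add field_simps)
  ultimately show ?thesis
    unfolding rational_curve_def by blast
qed

lemma rational_curve_sum:
  assumes "polynomial_curve d" "\<And>i. i \<in> I \<Longrightarrow> rational_curve d (h i)"
  shows "rational_curve d (\<lambda>t. \<Sum>i\<in>I. h i t)"
  using assms(2)
  by (induction I rule: infinite_finite_induct)
    (auto intro: rational_curve_add assms(1) rational_curve_polynomial polynomial_curve_intros)

lemma rational_curve_polynomial_fun:
  assumes "polynomial_curve d" "\<And>i j k. rational_curve d (\<lambda>t. c t $ i $ j $ k)"
  shows "polynomial_fun F \<Longrightarrow> rational_curve d (\<lambda>t. F (c t))"
  by (induction rule: polynomial_fun.induct)
    (auto intro: assms rational_curve_add rational_curve_mult rational_curve_polynomial
      polynomial_curve_intros)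

text \<open>Cramer's rule, which shows that inverting \<open>g\<close> introduces only the
  denominator \<open>det g\<close>.\<close>

lemma matrix_inv_component:
  fixes g :: "complex ^ 'n ^ 'n"
  assumes "det g \<noteq> 0"
  shows "(matrix_inv g *v x) $ k = det (\<chi> i j. if j = k then x $ i else g $ i $ j) / det g"
proof -
  have "matrix_inv g *v x =
      (\<chi> k. det (\<chi> i j. if j = k then x $ i else g $ i $ j) / det g)"
    using cramer[OF assms] matrix_inv_mult_vector(2)[OF assms] by blast
  from arg_cong[OF this, of "\<lambda>v. v $ k"] show ?thesis
    by (simp only: vec_lambda_beta)
qed

lemma rational_curve_cong:
  "rational_curve d f \<Longrightarrow> (\<And>t. d t \<noteq> 0 \<Longrightarrow> f t = f' t) \<Longrightarrow> rational_curve d f'"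
  unfolding rational_curve_def by auto

lemma rational_curve_transport:
  fixes g :: "complex \<Rightarrow> complex ^ 'n ^ 'n" and p :: "complex \<Rightarrow> 'n::finite structure_constants"
  assumes g: "\<And>i j. polynomial_curve (\<lambda>t. g t $ i $ j)"
    and p: "\<And>i j k. polynomial_curve (\<lambda>t. p t $ i $ j $ k)"
  shows "rational_curve (\<lambda>t. det (g t)) (\<lambda>t. transport (g t) (p t) $ i $ j $ k)"
proof -
  let ?d = "\<lambda>t. det (g t)"
  have d: "polynomial_curve ?d"
    using g by (rule polynomial_curve_det)
  have inv: "rational_curve ?d (\<lambda>t. (matrix_inv (g t) *v axis j 1) $ k)" for j k
  proof (rule rational_curve_cong)
    show "rational_curve ?d
        (\<lambda>t. det (\<chi> a b. if b = k then axis j 1 $ a else g t $ a $ b) / ?d t)"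
    proof (intro rational_curve_divide polynomial_curve_det)
      fix a b
      show "polynomial_curve (\<lambda>t. (\<chi> a b. if b = k then axis j 1 $ a else g t $ a $ b) $ a $ b)"
        by (cases "b = k") (auto intro: g polynomial_curve_intros)
    qed
  qed (simp add: matrix_inv_component)
  show ?thesis
    unfolding transport_def structure_of_def vec_lambda_beta alg_mult_def
      matrix_vector_mult_def[of "g _"]
    by (intro rational_curve_sum d rational_curve_mult inv g p rational_curve_polynomial)
qed

text \<open>A union of orbits under change of basis. The parameters are packed into an array of
  structure constants so that \<open>polynomial_fun\<close> can express polynomial dependence on
  them.\<close>

definition family ::
  "('n structure_constants \<Rightarrow> 'n structure_constants) \<Rightarrow> 'n::finite structure_constants set" where
  "family N = {transport g (N p) | g p. det g \<noteq> 0}"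

text \<open>Complex polynomials form an integral domain, and one that vanishes at every point is
  zero.\<close>

lemma polynomial_curve_zero_product:
  assumes "polynomial_curve f" "polynomial_curve g" "\<And>t. f t * g t = 0"
  shows "(\<forall>t. f t = 0) \<or> (\<forall>t. g t = 0)"
proof -
  obtain P Q where "f = poly P" "g = poly Q"
    using assms unfolding polynomial_curve_def by auto
  moreover have "P * Q = 0"
    by (metis assms(3) calculation poly_all_0_iff_0 poly_mult)
  ultimately show ?thesis
    by auto
qed

lemma not_in_algebraic_set:
  assumes "algebraic_set A" "x \<notin> A"
  obtains F where "polynomial_fun F" "F x \<noteq> 0" "\<And>y. y \<in> A \<Longrightarrow> F y = 0"
  using assms unfolding algebraic_set_def zero_locus_def by blast

lemma closedin_Leib:
  "closedin (subtopology zariski Leib) A \<longleftrightarrow> A \<subseteq> Leib \<and> algebraic_set A"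
  using closedin_closed_subtopology[OF closedin_zariski_Leib] by (auto simp: closedin_zariski)

text \<open>If \<open>x\<close> lies outside \<open>A\<close> and \<open>y\<close> outside
  \<open>B\<close>, join them by a rational curve in the family. Polynomials vanishing on
  \<open>A\<close> and on \<open>B\<close> but not at \<open>x\<close> and \<open>y\<close> have
  product zero along the curve, so one of them vanishes on all of it, which fails at an end.\<close>

lemma irreducible_family:
  fixes N :: "'n::finite structure_constants \<Rightarrow> 'n structure_constants"
  assumes N: "\<And>i j k. polynomial_fun (\<lambda>p. N p $ i $ j $ k)"
    and L: "\<And>p. N p \<in> Leib"
  shows "irreducible_in (subtopology zariski Leib) (family N)"
  unfolding irreducible_in_def
proof (intro conjI allI impI)
  show "family N \<subseteq> topspace (subtopology zariski Leib)"
    by (auto simp: topspace_zariski family_def L intro: transport_Leib)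
  have "transport (mat 1) (N 0) \<in> family N"
    unfolding family_def using det_I by fastforce
  then show "family N \<noteq> {}"
    by auto
next
  fix A B
  assume "closedin (subtopology zariski Leib) A \<and> closedin (subtopology zariski Leib) B \<and>
    family N \<subseteq> A \<union> B"
  then have A: "algebraic_set A" and B: "algebraic_set B" and AB: "family N \<subseteq> A \<union> B"
    by (auto simp: closedin_Leib)
  show "family N \<subseteq> A \<or> family N \<subseteq> B"
  proof (rule ccontr)
    assume "\<not> ?thesis"
    then obtain x y where x: "x \<in> family N" "x \<notin> A" and y: "y \<in> family N" "y \<notin> B"
      by auto
    obtain F where F: "polynomial_fun F" "F x \<noteq> 0" "\<And>c. c \<in> A \<Longrightarrow> F c = 0"
      using not_in_algebraic_set[OF A x(2)] by metis
    obtain G where G: "polynomial_fun G" "G y \<noteq> 0" "\<And>c. c \<in> B \<Longrightarrow> G c = 0"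
      using not_in_algebraic_set[OF B y(2)] by metis
    obtain g0 p0 where x': "x = transport g0 (N p0)" "det g0 \<noteq> 0"
      using x(1) by (auto simp: family_def)
    obtain g1 p1 where y': "y = transport g1 (N p1)" "det g1 \<noteq> 0"
      using y(1) by (auto simp: family_def)
    \<comment> \<open>The segment may meet singular matrices; \<open>c t\<close> is known to lie in
      the family only where \<open>det (g t)\<close> is nonzero.\<close>
    define g where "g t = (\<chi> i j. g0 $ i $ j + t * (g1 $ i $ j - g0 $ i $ j))" for t
    define c where "c t = transport (g t) (N (affine_line p0 p1 t))" for t
    let ?d = "\<lambda>t. det (g t)"
    have g: "polynomial_curve (\<lambda>t. g t $ i $ j)" for i j
      unfolding g_def vec_lambda_beta by (intro polynomial_curve_intros)
    have ends: "g 0 = g0" "g 1 = g1"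
      by (simp_all add: g_def vec_eq_iff)
    have d: "polynomial_curve ?d"
      by (intro polynomial_curve_det g)
    have c: "rational_curve ?d (\<lambda>t. c t $ i $ j $ k)" for i j k
      unfolding c_def by (intro rational_curve_transport g polynomial_curve_affine_line N)
    obtain m P where P: "polynomial_curve P" "\<And>t. ?d t \<noteq> 0 \<Longrightarrow> F (c t) = P t / ?d t ^ m"
      using rational_curve_polynomial_fun[OF d c F(1)] unfolding rational_curve_def by auto
    obtain n Q where Q: "polynomial_curve Q" "\<And>t. ?d t \<noteq> 0 \<Longrightarrow> G (c t) = Q t / ?d t ^ n"
      using rational_curve_polynomial_fun[OF d c G(1)] unfolding rational_curve_def by auto
    \<comment> \<open>The factor \<open>?d t\<close> extends the identity to the parameters where
      \<open>g t\<close> is singular.\<close>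
    have "P t * (Q t * ?d t) = 0" for t
    proof (cases "?d t = 0")
      case False
      then have "c t \<in> A \<union> B"
        using AB by (auto simp: family_def c_def)
      then have "F (c t) = 0 \<or> G (c t) = 0"
        using F(3) G(3) by auto
      then show ?thesis
        using P(2) Q(2) False by auto
    qed auto
    then have "(\<forall>t. P t = 0) \<or> (\<forall>t. Q t = 0) \<or> (\<forall>t. ?d t = 0)"
      using polynomial_curve_zero_product[OF P(1), of "\<lambda>t. Q t * ?d t"]
        polynomial_curve_zero_product[OF Q(1) d] polynomial_curve_intros(4)[OF Q(1) d] by blast
    \<comment> \<open>The curve is at \<open>x\<close> for \<open>t = 0\<close> and at
      \<open>y\<close> for \<open>t = 1\<close>.\<close>
    moreover have "P 0 \<noteq> 0" "Q 1 \<noteq> 0" "?d 0 \<noteq> 0"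
      using P(2)[of 0] Q(2)[of 1] F(2) G(2) ends x' y' by (auto simp: c_def)
    ultimately show False
      by blast
  qed
qed

section \<open>Irreducible sets and irreducible components\<close>

lemma irreducible_in_closure:
  assumes "irreducible_in X S"
  shows "irreducible_in X (X closure_of S)"
proof -
  have S: "S \<subseteq> topspace X" "S \<noteq> {}" "S \<subseteq> X closure_of S"
    using assms by (auto simp: irreducible_in_def closure_of_subset)
  have "X closure_of S \<subseteq> A \<or> X closure_of S \<subseteq> B"
    if "closedin X A" "closedin X B" "X closure_of S \<subseteq> A \<union> B" for A B
  proof -
    have "S \<subseteq> A \<or> S \<subseteq> B"
      using assms that S(3) unfolding irreducible_in_def by blast
    then show ?thesis
      using closure_of_minimal that(1,2) by metis
  qed
  then show ?thesis
    using S closure_of_subset_topspace[of X S] unfolding irreducible_in_def by blast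
qed

text \<open>Splits off one closed set at a time; the empty cover is excluded because irreducible
  sets are nonempty.\<close>

lemma irreducible_in_subset_Union:
  assumes "irreducible_in X C" "finite \<A>" "\<And>A. A \<in> \<A> \<Longrightarrow> closedin X A" "C \<subseteq> \<Union>\<A>"
  shows "\<exists>A\<in>\<A>. C \<subseteq> A"
  using assms(2-)
proof (induction \<A> rule: finite_induct)
  case empty
  then show ?case
    using assms(1) by (auto simp: irreducible_in_def)
next
  case (insert A \<A>)
  then have "closedin X (\<Union>\<A>)"
    by (intro closedin_Union) auto
  moreover have "closedin X A" "C \<subseteq> A \<union> \<Union>\<A>"
    using insert.prems by auto
  ultimately have "C \<subseteq> A \<or> C \<subseteq> \<Union>\<A>"
    using assms(1) unfolding irreducible_in_def by simp
  then show ?case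
    using insert.IH insert.prems(1) by blast
qed

text \<open>The closures of the families are irreducible and cover \<open>C\<close>, so one of them
  contains \<open>C\<close> and, by maximality, equals it.\<close>

lemma component_in_family:
  fixes \<N> :: "('n::finite structure_constants \<Rightarrow> 'n structure_constants) set"
  assumes C: "irreducible_component_of (subtopology zariski Leib) C"
    and "finite \<N>" "C \<subseteq> (\<Union>N\<in>\<N>. family N)"
    and poly: "\<And>N i j k. N \<in> \<N> \<Longrightarrow> polynomial_fun (\<lambda>p. N p $ i $ j $ k)"
    and L: "\<And>N p. N \<in> \<N> \<Longrightarrow> N p \<in> Leib"
  shows "\<exists>N\<in>\<N>. family N \<subseteq> C"
proof -
  let ?X = "subtopology zariski (Leib :: 'n structure_constants set)"
  let ?cl = "\<lambda>N. ?X closure_of (family N)"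
  have irr: "irreducible_in ?X (family N)" if "N \<in> \<N>" for N
    by (rule irreducible_family[OF poly[OF that] L[OF that]])
  have sub: "family N \<subseteq> ?cl N" if "N \<in> \<N>" for N
    using irr[OF that] unfolding irreducible_in_def by (intro closure_of_subset) (elim conjE)
  have "C \<subseteq> \<Union>(?cl ` \<N>)"
    by (rule order_trans[OF assms(3)]) (intro UN_mono order_refl sub)
  moreover have "irreducible_in ?X C"
    and max: "\<And>D. closedin ?X D \<Longrightarrow> irreducible_in ?X D \<Longrightarrow> C \<subseteq> D \<Longrightarrow> D = C"
    using C unfolding irreducible_component_of_def by simp_all
  ultimately have "\<exists>A\<in>?cl ` \<N>. C \<subseteq> A"
    using assms(2) by (intro irreducible_in_subset_Union[of ?X]) auto
  then obtain N where N: "N \<in> \<N>" "C \<subseteq> ?cl N"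
    by (elim bexE imageE) simp
  have "?cl N = C"
    by (intro max closedin_closure_of irreducible_in_closure irr N)
  then show ?thesis
    using sub[OF N(1)] N(1) by (intro bexI[of _ N]) simp_all
qed

lemma LeibI:
  assumes "bilinear_mult m"
    and "\<And>x y z. m (m x y) z = m (m x z) y + m x (m y z)"
  shows "structure_of m \<in> Leib"
  unfolding Leib_def mem_Collect_eq alg_mult_structure_of[OF assms(1)]
  by (intro allI assms(2))

text \<open>Right multiplication by \<open>y\<close> rescales \<open>u\<close> by a nonzero factor,
  so \<open>u\<close> stays in every term of the lower central series.\<close>

lemma not_nilpotent:
  assumes "alg_mult c u y = s *s u" "s \<noteq> 0" "u \<noteq> 0"
  shows "\<not> nilpotent_algebra c"
proof -
  have "u \<in> lower_central c m" for m
  proof (induction m)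
    case (Suc m)
    then have "s *s u \<in> lower_central c (Suc m)"
      unfolding lower_central.simps assms(1)[symmetric] by (intro vec.span_base) blast
    then have "inverse s *s (s *s u) \<in> lower_central c (Suc m)"
      unfolding lower_central.simps by (rule vec.span_scale)
    moreover have "inverse s *s (s *s u) = u"
      using assms(2) unfolding vector_smult_assoc by simp
    ultimately show ?case
      by (simp only:)
  qed simp
  then show ?thesis
    using assms(3) by (auto simp: nilpotent_algebra_def)
qed

subsection \<open>Five families of Leibniz algebras\<close>

definition coords4 :: "complex \<Rightarrow> complex \<Rightarrow> complex \<Rightarrow> complex \<Rightarrow> complex ^ 4" where
  "coords4 a b c d = (\<chi> i. if i = 1 then a else if i = 2 then b else if i = 3 then c else d)"

lemma coords4_nth [simp]:
  "coords4 a b c d $ 1 = a" "coords4 a b c d $ 2 = b"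
  "coords4 a b c d $ 3 = c" "coords4 a b c d $ 4 = d"
  by (simp_all add: coords4_def)

lemma vec4_eq_iff:
  fixes x y :: "complex ^ 4"
  shows "x = y \<longleftrightarrow> x $ 1 = y $ 1 \<and> x $ 2 = y $ 2 \<and> x $ 3 = y $ 3 \<and> x $ 4 = y $ 4"
  by (simp add: vec_eq_iff forall_4)

lemma polynomial_fun_coords4:
  assumes "polynomial_fun a" "polynomial_fun b" "polynomial_fun c" "polynomial_fun d"
  shows "polynomial_fun (\<lambda>p. coords4 (a p) (b p) (c p) (d p) $ k)"
  using assms exhaust_4[of k] by auto

lemma polynomial_fun_diff:
  assumes "polynomial_fun a" "polynomial_fun b"
  shows "polynomial_fun (\<lambda>p. a p - b p)"
  using polynomial_fun.add[OF assms(1)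
      polynomial_fun.mult[OF polynomial_fun.const[of "-1"] assms(2)]]
  by simp

lemmas poly_intros = polynomial_fun.intros polynomial_fun_diff polynomial_fun_coords4

text \<open>The family for \<open>dim L\<^sup>2 = 3\<close>. Right multiplication by
  \<open>e\<^sub>1\<close> is an arbitrary map into the span of the other basis vectors, whose own
  right multiplications vanish.\<close>

definition cyclic_mult ::
  "4 structure_constants \<Rightarrow> complex ^ 4 \<Rightarrow> complex ^ 4 \<Rightarrow> complex ^ 4" where
  "cyclic_mult p x y = (let D = \<lambda>k. \<Sum>i\<in>UNIV. x $ i * p $ i $ 1 $ k in
    coords4 0 (D 2 * y $ 1) (D 3 * y $ 1) (D 4 * y $ 1))"

text \<open>Every product has its first two coordinates zero, so \<open>x (y z) = 0\<close>. The
  Leibniz identity then says that right multiplications commute.\<close>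

lemma Leib_commuting:
  fixes E F :: "complex ^ 4 \<Rightarrow> complex ^ 4"
  assumes "\<And>x y. E (x + y) = E x + E y" "\<And>a x. E (a *s x) = a *s E x"
    and "\<And>x y. F (x + y) = F x + F y" "\<And>a x. F (a *s x) = a *s F x"
    and "\<And>x. E (F x) = F (E x)"
    and "\<And>x. E x $ 1 = 0" "\<And>x. E x $ 2 = 0" "\<And>x. F x $ 1 = 0" "\<And>x. F x $ 2 = 0"
  shows "structure_of (\<lambda>x y. y $ 1 *s E x + y $ 2 *s F x) \<in> Leib"
    and "bilinear_mult (\<lambda>x y. y $ 1 *s E x + y $ 2 *s F x)"
proof -
  show "bilinear_mult (\<lambda>x y. y $ 1 *s E x + y $ 2 *s F x)"
    unfolding bilinear_mult_def
    by (intro conjI allI)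
      (simp_all add: assms(1-4) vec.scale_right_distrib vec.scale_left_distrib
        vector_smult_assoc mult.commute)
  then show "structure_of (\<lambda>x y. y $ 1 *s E x + y $ 2 *s F x) \<in> Leib"
  proof (rule LeibI, goal_cases)
    case (1 x y z)
    show ?case
      unfolding vector_add_component vector_smult_component assms
      by (simp add: vec.scale_right_distrib mult.commute add_ac)
  qed
qed

text \<open>
  Right multiplication by \<open>e\<^sub>j\<close>, \<open>j = 1, 2\<close>, is a \<open>2 \<times> 2\<close> matrix \<open>n\<^sub>j\<close> on \<open>\<langle>e\<^sub>1, e\<^sub>2\<rangle>\<close>, with values in
  \<open>\<langle>e\<^sub>3, e\<^sub>4\<rangle>\<close>. Letting \<open>e\<^sub>j\<close> act on \<open>\<langle>e\<^sub>3, e\<^sub>4\<rangle>\<close> by \<open>t n\<^sub>j adj(n\<^sub>1)\<close> keeps the two right multiplications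
  commuting. In all families but the cyclic one, the deformation parameter \<open>t\<close> is \<open>p $ 4 $ 4 $ 4\<close>.
\<close>

definition two_step_mult ::
  "4 structure_constants \<Rightarrow> complex ^ 4 \<Rightarrow> complex ^ 4 \<Rightarrow> complex ^ 4" where
  "two_step_mult p x y = (let t = p $ 4 $ 4 $ 4;
      a = p $ 1 $ 1 $ 3; b = p $ 2 $ 1 $ 3; c = p $ 1 $ 1 $ 4; d = p $ 2 $ 1 $ 4;
      a' = p $ 1 $ 2 $ 3; b' = p $ 2 $ 2 $ 3; c' = p $ 1 $ 2 $ 4; d' = p $ 2 $ 2 $ 4;
      r = t * (a * d - b * c)
    in y $ 1 *s coords4 0 0
        (a * x $ 1 + b * x $ 2 + r * x $ 3) (c * x $ 1 + d * x $ 2 + r * x $ 4) +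
      y $ 2 *s coords4 0 0
        (a' * x $ 1 + b' * x $ 2 + t * ((a' * d - b' * c) * x $ 3 + (b' * a - a' * b) * x $ 4))
        (c' * x $ 1 + d' * x $ 2 + t * ((c' * d - d' * c) * x $ 3 + (d' * a - c' * b) * x $ 4)))"

text \<open>Both composites of the right multiplications send
  \<open>\<langle>e\<^sub>1, e\<^sub>2\<rangle>\<close> by
  \<open>t det(n\<^sub>1) n\<^sub>2\<close>, as \<open>n\<^sub>1\<close> commutes with its adjugate;
  on \<open>\<langle>e\<^sub>3, e\<^sub>4\<rangle>\<close> the first one is the scalar
  \<open>r\<close>.\<close>

lemma two_step_mult_Leib:
  "structure_of (two_step_mult p) \<in> Leib" "bilinear_mult (two_step_mult p)"
  unfolding two_step_mult_def[abs_def] Let_def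
  by (rule Leib_commuting; simp add: vec4_eq_iff algebra_simps)+

text \<open>
  Modulo \<open>e\<^sub>n\<close> the multiplication is the Lie bracket \<open>f(y) D x - f(x) D y\<close>; the form \<open>B\<close> plays
  the role of a cocycle.
\<close>

lemma Leib_extension:
  fixes B :: "complex ^ 'n \<Rightarrow> complex ^ 'n \<Rightarrow> complex" and D :: "complex ^ 'n \<Rightarrow> complex ^ 'n::finite"
  assumes B: "\<And>x y z. B (x + y) z = B x z + B y z" "\<And>a x z. B (a *s x) z = a * B x z"
      "\<And>x y z. B z (x + y) = B z x + B z y" "\<And>a x z. B z (a *s x) = a * B z x"
      "\<And>x. B x (axis n 1) = 0" "\<And>x. B (axis n 1) x = 0"
    and f: "\<And>x y. f (x + y) = f x + f y" "\<And>a x. f (a *s x) = a * f x" "f (axis n 1) = 0"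
    and D: "\<And>x y. D (x + y) = D x + D y" "\<And>a x. D (a *s x) = a *s D x"
      "\<And>x. D x $ n = 0" "D (axis n 1) = 0"
    and fD: "\<And>x. f (D x) = s * f x"
    and BD: "\<And>x y. B (D x) y + B x (D y) = r * B x y" "\<And>x y. B (D x) y = B (D y) x"
  defines "m \<equiv> \<lambda>x y. (B x y + r * f y * x $ n) *s axis n 1 + (f y *s D x + (- f x) *s D y)"
  shows "structure_of m \<in> Leib" "bilinear_mult m"
proof -
  show bil: "bilinear_mult m"
    unfolding bilinear_mult_def
    by (intro conjI allI)
      (simp_all add: m_def B(1-4) f(1,2) D(1,2) vec.scale_right_distrib vec.scale_left_distrib
        algebra_simps)
  have m: "m x y = (B x y + r * f y * x $ n) *s axis n 1 + (f y *s D x + (- f x) *s D y)" for x y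
    by (simp add: m_def)
  have BxD: "B x (D y) = r * B x y - B (D x) y" for x y
    using BD(1)[of x y] by (simp add: algebra_simps)
  have c: "m x y $ n = B x y + r * f y * x $ n" for x y
    by (simp add: m_def D)
  \<comment> \<open>By \<open>fD\<close> the two \<open>D\<close> terms contribute
    \<open>s * f x * f y\<close> with opposite signs.\<close>
  have fm: "f (m x y) = 0" for x y
    unfolding m f fD by simp
  have Dm: "D (m x y) = f y *s D (D x) + (- f x) *s D (D y)" for x y
    unfolding m D by simp
  have Bm: "B (m x y) z = f y * B (D x) z - f x * B (D y) z" for x y z
    unfolding m B by simp
  have mB: "B z (m x y) = f y * B z (D x) - f x * B z (D y)" for x y z
    unfolding m B by simp
  show "structure_of m \<in> Leib"
  proof (rule LeibI[OF bil])
    fix x y z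
    have 1: "m (m x y) z =
        (B (m x y) z + r * f z * m x y $ n) *s axis n 1 + f z *s D (m x y)" for x y z
      using m[of "m x y" z] by (simp add: fm)
    have 2: "m x (m y z) = B x (m y z) *s axis n 1 + (- f x) *s D (m y z)"
      using m[of x "m y z"] by (simp add: fm)
    show "m (m x y) z = m (m x z) y + m x (m y z)"
    proof -
      \<comment> \<open>After \<open>D\<close> is moved to the first argument of \<open>B\<close>,
        all that remains is to compare \<open>B (D y) z\<close> with \<open>B (D z) y\<close>. The
        multiples of \<open>r\<close> match because of the term \<open>r * f y * x $ n\<close> of
        \<open>m\<close>.\<close>
      have e: "B (m x y) z + r * f z * m x y $ n =
          B (m x z) y + r * f y * m x z $ n + B x (m y z)"
        unfolding c Bm mB BxD BD(2)[of z y] by (simp add: algebra_simps)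
      show ?thesis
        unfolding 1 2 e Dm
        by (simp add: vec.scale_right_distrib vec.scale_left_distrib mult.commute)
    qed
  qed
qed

text \<open>
  For the form \<open>B\<close> on \<open>\<langle>e\<^sub>1, e\<^sub>2, e\<^sub>3\<rangle>\<close> with matrix \<open>p $ i $ j $ 4\<close>, take \<open>S = B + B\<^sup>T\<close>,
  \<open>D = t adj(S) B\<close> and \<open>f = w\<^sup>T S\<close>, where \<open>w\<close> is the vector in the kernel of the alternating matrix
  \<open>B - B\<^sup>T\<close>. Then \<open>D\<^sup>T B = t B\<^sup>T adj(S) B\<close> is symmetric, \<open>D\<^sup>T B + B D = t S adj(S) B = t det(S) B\<close>, and
  \<open>f D = t det(S) w\<^sup>T B\<close> is \<open>t det(S) / 2\<close> times \<open>f\<close>.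
\<close>

definition row_form :: "4 structure_constants \<Rightarrow> 4 \<Rightarrow> complex ^ 4 \<Rightarrow> complex" where
  "row_form p i y = p $ i $ 1 $ 4 * y $ 1 + p $ i $ 2 $ 4 * y $ 2 + p $ i $ 3 $ 4 * y $ 3"

definition col_form :: "4 structure_constants \<Rightarrow> 4 \<Rightarrow> complex ^ 4 \<Rightarrow> complex" where
  "col_form p j x = p $ 1 $ j $ 4 * x $ 1 + p $ 2 $ j $ 4 * x $ 2 + p $ 3 $ j $ 4 * x $ 3"

definition bil_form :: "4 structure_constants \<Rightarrow> complex ^ 4 \<Rightarrow> complex ^ 4 \<Rightarrow> complex" where
  "bil_form p x y = x $ 1 * row_form p 1 y + x $ 2 * row_form p 2 y + x $ 3 * row_form p 3 y"

definition sym_coeff :: "4 structure_constants \<Rightarrow> 4 \<Rightarrow> 4 \<Rightarrow> complex" where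
  "sym_coeff p i j = p $ i $ j $ 4 + p $ j $ i $ 4"

definition cofactor2 :: "4 structure_constants \<Rightarrow> 4 \<Rightarrow> 4 \<Rightarrow> 4 \<Rightarrow> 4 \<Rightarrow> complex" where
  "cofactor2 p i j k l =
    sym_coeff p i k * sym_coeff p j l - sym_coeff p i l * sym_coeff p j k"

definition sym_det :: "4 structure_constants \<Rightarrow> complex" where
  "sym_det p = sym_coeff p 1 1 * cofactor2 p 2 3 2 3 + sym_coeff p 1 2 * cofactor2 p 2 3 3 1 +
    sym_coeff p 1 3 * cofactor2 p 2 3 1 2"

definition adj_form :: "4 structure_constants \<Rightarrow> complex ^ 4 \<Rightarrow> complex ^ 4" where
  "adj_form p x = p $ 4 $ 4 $ 4 *s coords4
    (cofactor2 p 2 3 2 3 * row_form p 1 x + cofactor2 p 2 3 3 1 * row_form p 2 x +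
      cofactor2 p 2 3 1 2 * row_form p 3 x)
    (cofactor2 p 3 1 2 3 * row_form p 1 x + cofactor2 p 3 1 3 1 * row_form p 2 x +
      cofactor2 p 3 1 1 2 * row_form p 3 x)
    (cofactor2 p 1 2 2 3 * row_form p 1 x + cofactor2 p 1 2 3 1 * row_form p 2 x +
      cofactor2 p 1 2 1 2 * row_form p 3 x)
    0"

definition kernel_form :: "4 structure_constants \<Rightarrow> complex ^ 4 \<Rightarrow> complex" where
  "kernel_form p y =
    (p $ 2 $ 3 $ 4 - p $ 3 $ 2 $ 4) * (row_form p 1 y + col_form p 1 y) +
    (p $ 3 $ 1 $ 4 - p $ 1 $ 3 $ 4) * (row_form p 2 y + col_form p 2 y) +
    (p $ 1 $ 2 $ 4 - p $ 2 $ 1 $ 4) * (row_form p 3 y + col_form p 3 y)"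

lemma bil_form_col:
  "bil_form p x y = col_form p 1 x * y $ 1 + col_form p 2 x * y $ 2 + col_form p 3 x * y $ 3"
  by (simp add: bil_form_def row_form_def col_form_def algebra_simps)

lemma row_col_form:
  "row_form p i x + col_form p i x =
    sym_coeff p i 1 * x $ 1 + sym_coeff p i 2 * x $ 2 + sym_coeff p i 3 * x $ 3"
  by (simp add: row_form_def col_form_def sym_coeff_def algebra_simps)

lemma sym_coeff_commute:
  "sym_coeff p 2 1 = sym_coeff p 1 2" "sym_coeff p 3 1 = sym_coeff p 1 3"
  "sym_coeff p 3 2 = sym_coeff p 2 3"
  by (simp_all add: sym_coeff_def add.commute)

text \<open>The rows of \<open>S adj(S) = det(S)\<close>, applied to the vector
  \<open>B x\<close>.\<close>

lemma sym_adj_form: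
  "sym_coeff p 1 1 * adj_form p x $ 1 + sym_coeff p 1 2 * adj_form p x $ 2 +
    sym_coeff p 1 3 * adj_form p x $ 3 = p $ 4 $ 4 $ 4 * sym_det p * row_form p 1 x"
  "sym_coeff p 2 1 * adj_form p x $ 1 + sym_coeff p 2 2 * adj_form p x $ 2 +
    sym_coeff p 2 3 * adj_form p x $ 3 = p $ 4 $ 4 $ 4 * sym_det p * row_form p 2 x"
  "sym_coeff p 3 1 * adj_form p x $ 1 + sym_coeff p 3 2 * adj_form p x $ 2 +
    sym_coeff p 3 3 * adj_form p x $ 3 = p $ 4 $ 4 $ 4 * sym_det p * row_form p 3 x"
  by (simp_all add: adj_form_def sym_det_def cofactor2_def sym_coeff_commute algebra_simps)

lemma kernel_form_adj_form:
  "kernel_form p (adj_form p x) = p $ 4 $ 4 $ 4 * sym_det p / 2 * kernel_form p x"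
proof -
  have "kernel_form p (adj_form p x) = p $ 4 $ 4 $ 4 * sym_det p *
      ((p $ 2 $ 3 $ 4 - p $ 3 $ 2 $ 4) * row_form p 1 x +
       (p $ 3 $ 1 $ 4 - p $ 1 $ 3 $ 4) * row_form p 2 x +
       (p $ 1 $ 2 $ 4 - p $ 2 $ 1 $ 4) * row_form p 3 x)"
    unfolding kernel_form_def row_col_form sym_adj_form by (simp add: algebra_simps)
  \<comment> \<open>Since \<open>w\<close> is in the kernel of \<open>B - B\<^sup>T\<close>,
    \<open>w\<^sup>T S = 2 w\<^sup>T B\<close>.\<close>
  moreover have "kernel_form p x = 2 *
      ((p $ 2 $ 3 $ 4 - p $ 3 $ 2 $ 4) * row_form p 1 x +
       (p $ 3 $ 1 $ 4 - p $ 1 $ 3 $ 4) * row_form p 2 x +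
       (p $ 1 $ 2 $ 4 - p $ 2 $ 1 $ 4) * row_form p 3 x)"
    by (simp add: kernel_form_def row_form_def col_form_def algebra_simps)
  ultimately show ?thesis
    by simp
qed

lemma bil_form_adj_form_commute: "bil_form p (adj_form p x) y = bil_form p (adj_form p y) x"
  by (simp add: bil_form_def adj_form_def cofactor2_def sym_coeff_commute algebra_simps)

lemma bil_form_adj_form:
  "bil_form p (adj_form p x) y + bil_form p x (adj_form p y) =
    p $ 4 $ 4 $ 4 * sym_det p * bil_form p x y"
proof -
  let ?D = "adj_form p y"
  \<comment> \<open>Exchanging \<open>x\<close> and \<open>y\<close> in the first term turns the sum
    into \<open>x\<^sup>T S D y\<close>.\<close>
  have "bil_form p (adj_form p x) y + bil_form p x ?D =
      (row_form p 1 x + col_form p 1 x) * ?D $ 1 + (row_form p 2 x + col_form p 2 x) * ?D $ 2 +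
      (row_form p 3 x + col_form p 3 x) * ?D $ 3"
    unfolding bil_form_adj_form_commute[of p x y] bil_form_col[of p x] bil_form_def[of p ?D x]
    by (simp add: algebra_simps)
  also have "\<dots> =
      x $ 1 * (sym_coeff p 1 1 * ?D $ 1 + sym_coeff p 1 2 * ?D $ 2 + sym_coeff p 1 3 * ?D $ 3) +
      x $ 2 * (sym_coeff p 2 1 * ?D $ 1 + sym_coeff p 2 2 * ?D $ 2 + sym_coeff p 2 3 * ?D $ 3) +
      x $ 3 * (sym_coeff p 3 1 * ?D $ 1 + sym_coeff p 3 2 * ?D $ 2 + sym_coeff p 3 3 * ?D $ 3)"
    unfolding row_col_form sym_coeff_commute by (simp add: algebra_simps)
  also have "\<dots> = p $ 4 $ 4 $ 4 * sym_det p * bil_form p x y"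
    unfolding sym_adj_form bil_form_def by (simp add: algebra_simps)
  finally show ?thesis .
qed

definition extension_mult ::
  "4 structure_constants \<Rightarrow> complex ^ 4 \<Rightarrow> complex ^ 4 \<Rightarrow> complex ^ 4" where
  "extension_mult p x y =
    (bil_form p x y + p $ 4 $ 4 $ 4 * sym_det p * kernel_form p y * x $ 4) *s axis 4 1 +
    (kernel_form p y *s adj_form p x + (- kernel_form p x) *s adj_form p y)"

lemma extension_mult_Leib:
  "structure_of (extension_mult p) \<in> Leib" "bilinear_mult (extension_mult p)"
  unfolding extension_mult_def[abs_def]
  by (rule Leib_extension[where B = "bil_form p" and f = "kernel_form p" and D = "adj_form p"
      and s = "p $ 4 $ 4 $ 4 * sym_det p / 2"];
    (rule bil_form_adj_form bil_form_adj_form_commute kernel_form_adj_form)?;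
    simp add: bil_form_def kernel_form_def adj_form_def row_form_def col_form_def vec4_eq_iff
      axis_def algebra_simps)+

text \<open>
  In the last two families \<open>v = e\<^sub>3\<close> and \<open>u = e\<^sub>4\<close>, and \<open>u\<close> is replaced by \<open>u + t v\<close> in the products
  \<open>v x\<close> and \<open>x v\<close>.
\<close>

definition three_step_mult ::
  "4 structure_constants \<Rightarrow> complex ^ 4 \<Rightarrow> complex ^ 4 \<Rightarrow> complex ^ 4" where
  "three_step_mult p x y = (let t = p $ 4 $ 4 $ 4;
      h = p $ 1 $ 4 $ 4 * x $ 1 + p $ 2 $ 4 $ 4 * x $ 2;
      f = p $ 3 $ 1 $ 4 * y $ 1 + p $ 3 $ 2 $ 4 * y $ 2
    in coords4 0 0 (h * f + t * x $ 3 * f)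
      (p $ 1 $ 1 $ 4 * x $ 1 * y $ 1 + p $ 1 $ 2 $ 4 * x $ 1 * y $ 2 +
       p $ 2 $ 1 $ 4 * x $ 2 * y $ 1 + p $ 2 $ 2 $ 4 * x $ 2 * y $ 2 + x $ 3 * f))"

definition skew_three_step_mult ::
  "4 structure_constants \<Rightarrow> complex ^ 4 \<Rightarrow> complex ^ 4 \<Rightarrow> complex ^ 4" where
  "skew_three_step_mult p x y = (let t = p $ 4 $ 4 $ 4;
      f = p $ 3 $ 1 $ 4 * y $ 1 + p $ 3 $ 2 $ 4 * y $ 2;
      f' = p $ 3 $ 1 $ 4 * x $ 1 + p $ 3 $ 2 $ 4 * x $ 2;
      w = x $ 3 * f - f' * y $ 3
    in coords4 0 0 (p $ 1 $ 2 $ 3 * (x $ 1 * y $ 2 - x $ 2 * y $ 1) + t * w)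
      (p $ 1 $ 1 $ 4 * x $ 1 * y $ 1 + p $ 1 $ 2 $ 4 * x $ 1 * y $ 2 +
       p $ 2 $ 1 $ 4 * x $ 2 * y $ 1 + p $ 2 $ 2 $ 4 * x $ 2 * y $ 2 + w))"

section \<open>Leibniz identity, polynomial dependence and non-nilpotent members\<close>

lemma bilinear_cyclic_mult: "bilinear_mult (cyclic_mult p)"
  by (simp add: bilinear_mult_def vec4_eq_iff cyclic_mult_def Let_def sum_4 algebra_simps)

lemma bilinear_three_step_mult: "bilinear_mult (three_step_mult p)"
  by (simp add: bilinear_mult_def vec4_eq_iff three_step_mult_def Let_def algebra_simps)

lemma bilinear_skew_three_step_mult: "bilinear_mult (skew_three_step_mult p)"
  by (simp add: bilinear_mult_def vec4_eq_iff skew_three_step_mult_def Let_def algebra_simps)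

lemma cyclic_mult_Leib: "structure_of (cyclic_mult p) \<in> Leib"
  by (intro LeibI bilinear_cyclic_mult)
    (simp add: vec4_eq_iff cyclic_mult_def Let_def sum_4 algebra_simps)

text \<open>Products lie in \<open>\<langle>e\<^sub>3, e\<^sub>4\<rangle>\<close>, by which right
  multiplication is zero, so \<open>(x y) z\<close> must be symmetric in \<open>y\<close> and
  \<open>z\<close>. It is: the third coordinate of \<open>x y\<close> is a function of
  \<open>x\<close> times \<open>f(y)\<close>, and \<open>e\<^sub>3 z\<close> is \<open>f(z)\<close>
  times a fixed vector.\<close>

lemma three_step_mult_Leib: "structure_of (three_step_mult p) \<in> Leib"
  by (intro LeibI bilinear_three_step_mult)
    (simp add: vec4_eq_iff three_step_mult_def Let_def algebra_simps)

text \<open>With \<open>s\<close> the third coordinate of the product, an alternating form, the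
  identity says that the 3-form \<open>s \<and> f\<close> vanishes. It does: \<open>s\<close>
  combines the wedge of the first two coordinate forms, which span a plane containing
  \<open>f\<close>, with a wedge having \<open>f\<close> as a factor.\<close>

lemma skew_three_step_mult_Leib: "structure_of (skew_three_step_mult p) \<in> Leib"
  by (intro LeibI bilinear_skew_three_step_mult)
    (simp add: vec4_eq_iff skew_three_step_mult_def Let_def algebra_simps)

lemma polynomial_fun_uminus: "polynomial_fun a \<Longrightarrow> polynomial_fun (\<lambda>p. - a p)"
  using polynomial_fun_diff[OF polynomial_fun.const[of 0]] by simp

lemma polynomial_families:
  "polynomial_fun (\<lambda>p. structure_of (cyclic_mult p) $ i $ j $ k)"
  "polynomial_fun (\<lambda>p. structure_of (extension_mult p) $ i $ j $ k)"
  "polynomial_fun (\<lambda>p. structure_of (two_step_mult p) $ i $ j $ k)"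
  "polynomial_fun (\<lambda>p. structure_of (three_step_mult p) $ i $ j $ k)"
  "polynomial_fun (\<lambda>p. structure_of (skew_three_step_mult p) $ i $ j $ k)"
  unfolding structure_of_def vec_lambda_beta cyclic_mult_def extension_mult_def two_step_mult_def
    three_step_mult_def skew_three_step_mult_def
    Let_def sum_4 bil_form_def kernel_form_def adj_form_def row_form_def col_form_def sym_det_def
    cofactor2_def sym_coeff_def vector_add_component vector_smult_component
  by (intro poly_intros polynomial_fun_uminus)+

lemma non_nilpotent_examples:
  "\<exists>p. \<not> nilpotent_algebra (structure_of (cyclic_mult p))"
  "\<exists>p. \<not> nilpotent_algebra (structure_of (extension_mult p))"
  "\<exists>p. \<not> nilpotent_algebra (structure_of (two_step_mult p))"
  "\<exists>p. \<not> nilpotent_algebra (structure_of (three_step_mult p))"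
  "\<exists>p. \<not> nilpotent_algebra (structure_of (skew_three_step_mult p))"
proof -
  let ?one = "(\<chi> i j k. 1) :: 4 structure_constants"
  show "\<exists>p. \<not> nilpotent_algebra (structure_of (cyclic_mult p))"
    \<comment> \<open>Right multiplication by \<open>e\<^sub>1\<close> multiplies the coordinate sum
      by the vector \<open>u\<close>, whose own coordinate sum is 3.\<close>
    by (rule exI[of _ ?one],
        rule not_nilpotent[where u = "coords4 0 1 1 1" and y = "axis 1 1" and s = 3])
      (simp_all add: alg_mult_structure_of bilinear_cyclic_mult cyclic_mult_def Let_def sum_4
        vec4_eq_iff axis_def)
  show "\<exists>p. \<not> nilpotent_algebra (structure_of (extension_mult p))"
    \<comment> \<open>\<open>B\<close> is the identity plus one entry above the diagonal, which
      makes \<open>w = (0, 0, 1)\<close> while \<open>det(S) = 6\<close>; as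
      \<open>f(e\<^sub>3) = 2\<close>, the eigenvalue is 12.\<close>
    by (rule exI[of _ "\<chi> i j k. if i = j \<or> i = 1 \<and> j = 2 then 1 else 0"],
        rule not_nilpotent[where u = "axis 4 1" and y = "axis 3 1" and s = 12])
      (simp_all add: alg_mult_structure_of extension_mult_Leib extension_mult_def bil_form_def
        kernel_form_def adj_form_def row_form_def col_form_def sym_det_def cofactor2_def
        sym_coeff_def vec4_eq_iff axis_def)
  show "\<exists>p. \<not> nilpotent_algebra (structure_of (two_step_mult p))"
    \<comment> \<open>\<open>n\<^sub>1\<close> becomes triangular with determinant 1, whereas equal
      parameters would make it singular.\<close>
    by (rule exI[of _ "\<chi> i j k. if i = 2 \<and> k = 3 then 0 else 1"],
        rule not_nilpotent[where u = "axis 4 1" and y = "axis 1 1" and s = 1])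
      (simp_all add: alg_mult_structure_of two_step_mult_Leib two_step_mult_def
        Let_def vec4_eq_iff axis_def)
  show "\<exists>p. \<not> nilpotent_algebra (structure_of (three_step_mult p))"
    \<comment> \<open>Here \<open>v e\<^sub>1 = u + t v\<close> with \<open>t = 1\<close> and
      \<open>u e\<^sub>1 = 0\<close>, so the sum of \<open>v = e\<^sub>3\<close> and
      \<open>u = e\<^sub>4\<close> is fixed.\<close>
    by (rule exI[of _ ?one],
        rule not_nilpotent[where u = "coords4 0 0 1 1" and y = "axis 1 1" and s = 1])
      (simp_all add: alg_mult_structure_of bilinear_three_step_mult three_step_mult_def
        Let_def vec4_eq_iff axis_def)
  show "\<exists>p. \<not> nilpotent_algebra (structure_of (skew_three_step_mult p))"
    by (rule exI[of _ ?one],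
        rule not_nilpotent[where u = "coords4 0 0 1 1" and y = "axis 1 1" and s = 1])
      (simp_all add: alg_mult_structure_of bilinear_skew_three_step_mult
        skew_three_step_mult_def Let_def vec4_eq_iff axis_def)
qed

subsection \<open>Nilpotent algebras of dimension four\<close>

text \<open>A basis, expressed as successive choices from \<open>u\<close> back to \<open>a\<close>,
  the order in which the vectors are found.\<close>

definition flag4 :: "complex ^ 4 \<Rightarrow> complex ^ 4 \<Rightarrow> complex ^ 4 \<Rightarrow> complex ^ 4 \<Rightarrow> bool" where
  "flag4 a b v u \<longleftrightarrow> u \<noteq> 0 \<and> v \<notin> vec.span {u} \<and> b \<notin> vec.span {v, u} \<and> a \<notin> vec.span {b, v, u}"

definition basis4 :: "complex ^ 4 \<Rightarrow> complex ^ 4 \<Rightarrow> complex ^ 4 \<Rightarrow> complex ^ 4 \<Rightarrow> complex ^ 4 ^ 4" where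
  "basis4 a b v u = (\<chi> r. coords4 (a $ r) (b $ r) (v $ r) (u $ r))"

lemma basis4_mult: "basis4 a b v u *v x = x $ 1 *s a + x $ 2 *s b + x $ 3 *s v + x $ 4 *s u"
  by (simp add: basis4_def matrix_vector_mult_def vec_eq_iff sum_4 mult.commute)

lemma notin_span_coeff:
  assumes "a \<notin> vec.span S" "t *s a + y = 0" "y \<in> vec.span S"
  shows "t = (0::complex)"
proof (rule ccontr)
  assume "t \<noteq> 0"
  have "t *s a = - y"
    using assms(2) by (simp add: eq_neg_iff_add_eq_0)
  then have "inverse t *s (t *s a) \<in> vec.span S"
    using assms(3) by (metis vec.span_neg vec.span_scale)
  then show False
    using \<open>t \<noteq> 0\<close> assms(1) by (simp add: vector_smult_assoc)
qed

lemma flag4_det: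
  assumes "flag4 a b v u"
  shows "det (basis4 a b v u) \<noteq> 0"
proof -
  have "x = 0" if x: "basis4 a b v u *v x = 0" for x
  proof -
    have e: "x $ 1 *s a + (x $ 2 *s b + (x $ 3 *s v + x $ 4 *s u)) = 0"
      using x by (simp add: basis4_mult add.assoc)
    have x1: "x $ 1 = 0"
      using assms unfolding flag4_def
      by (intro notin_span_coeff[OF _ e, of "{b, v, u}"])
        (auto intro!: vec.span_add vec.span_scale intro: vec.span_base)
    then have e: "x $ 2 *s b + (x $ 3 *s v + x $ 4 *s u) = 0"
      using e by simp
    have x2: "x $ 2 = 0"
      using assms unfolding flag4_def
      by (intro notin_span_coeff[OF _ e, of "{v, u}"])
        (auto intro!: vec.span_add vec.span_scale intro: vec.span_base)
    then have e: "x $ 3 *s v + x $ 4 *s u = 0"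
      using e by simp
    have x3: "x $ 3 = 0"
      using assms unfolding flag4_def
      by (intro notin_span_coeff[OF _ e, of "{u}"])
        (auto intro!: vec.span_scale intro: vec.span_base)
    then have "x $ 4 = 0"
      using e assms by (simp add: flag4_def)
    with x1 x2 x3 show ?thesis
      by (simp add: vec4_eq_iff)
  qed
  then have "invertible (basis4 a b v u)"
    by (simp add: invertible_left_inverse matrix_left_invertible_ker)
  then show ?thesis
    by (simp add: invertible_det_nz)
qed

lemma flag4_expand:
  assumes "flag4 a b v u"
  obtains s1 s2 s3 s4 where "x = s1 *s a + s2 *s b + s3 *s v + s4 *s u"
proof -
  let ?y = "matrix_inv (basis4 a b v u) *v x"
  have "x = basis4 a b v u *v ?y"
    using matrix_inv_mult_vector(2)[OF flag4_det[OF assms]] by simp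
  then show ?thesis
    using that unfolding basis4_mult by blast
qed

lemma ex_notin_span:
  assumes "finite S" "card S < 4"
  shows "\<exists>x :: complex ^ 4. x \<notin> vec.span S"
proof (rule ccontr)
  assume "\<not> ?thesis"
  then have "vec.dim (UNIV :: (complex ^ 4) set) \<le> card S"
    using assms(1) by (intro vec.dim_le_card) auto
  then show False
    using assms(2) by (simp add: vec.dim_UNIV card_cart_basis)
qed

lemma ex_notin_span3: "\<exists>x :: complex ^ 4. x \<notin> vec.span {a, b, c}"
  "\<exists>x :: complex ^ 4. x \<notin> vec.span {b, c}" "\<exists>x :: complex ^ 4. x \<notin> vec.span {c}"
  by (intro ex_notin_span; simp add: card_insert_if)+

lemma span_singleton_iff: "x \<in> vec.span {u} \<longleftrightarrow> (\<exists>t. x = t *s u)"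
  by (auto simp: vec.span_singleton)

lemma span_pair_iff: "x \<in> vec.span {v, u} \<longleftrightarrow> (\<exists>s t. x = s *s v + t *s u)"
  unfolding vec.span_breakdown_eq[of x v] span_singleton_iff
  by (simp add: diff_eq_eq add.commute)

lemma span_triple_iff: "x \<in> vec.span {b, v, u} \<longleftrightarrow> (\<exists>r s t. x = r *s b + s *s v + t *s u)"
  unfolding vec.span_breakdown_eq[of x b] span_pair_iff
  by (simp add: diff_eq_eq add_ac)

text \<open>Reduces membership in a family to comparing the sixteen products in a basis adapted to
  the algebra.\<close>

lemma familyI:
  assumes "flag4 a b v u" "bilinear_mult m" "structure_of m = N p"
    and "\<And>i j. alg_mult c (basis4 a b v u *v axis i 1) (basis4 a b v u *v axis j 1) =
      basis4 a b v u *v m (axis i 1) (axis j 1)"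
  shows "c \<in> family N"
proof -
  have "transport (basis4 a b v u) (N p) = c"
    by (rule transport_eqI[OF flag4_det[OF assms(1)]])
      (simp add: assms(4) assms(3)[symmetric] structure_of_def)
  then show ?thesis
    using flag4_det[OF assms(1)] unfolding family_def by blast
qed

lemma basis4_axis:
  "basis4 a b v u *v axis 1 1 = a" "basis4 a b v u *v axis 2 1 = b"
  "basis4 a b v u *v axis 3 1 = v" "basis4 a b v u *v axis 4 1 = u"
  by (simp_all add: basis4_mult axis_def)

section \<open>The lower central series of a Leibniz algebra\<close>

declare lower_central.simps(2) [simp del]

lemma lower_central_subspace: "vec.subspace (lower_central c m)"
  by (cases m) (auto simp: lower_central.simps(2))

lemma lower_central_mult: "x \<in> lower_central c m \<Longrightarrow> alg_mult c x y \<in> lower_central c (Suc m)"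
  by (auto simp: lower_central.simps(2) intro: vec.span_base)

lemma lower_central_subset:
  assumes "vec.subspace S" "\<And>x y. x \<in> lower_central c m \<Longrightarrow> alg_mult c x y \<in> S"
  shows "lower_central c (Suc m) \<subseteq> S"
  unfolding lower_central.simps using assms by (intro vec.span_minimal) auto

lemma lower_central_decreasing: "lower_central c (Suc m) \<subseteq> lower_central c m"
proof (induction m)
  case (Suc m)
  show ?case
    using Suc by (intro lower_central_subset lower_central_subspace lower_central_mult) blast
qed simp

text \<open>A series that stops once stays constant from there on, and nilpotency makes that
  constant zero.\<close>

lemma lower_central_stationary:
  assumes "nilpotent_algebra c" "lower_central c (Suc m) = lower_central c m"
  shows "lower_central c m = {0}"
proof -
  have const: "lower_central c (m + n) = lower_central c m" for n
    by (induction n) (use assms(2) in \<open>auto simp: lower_central.simps(2)\<close>)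
  obtain k where k: "lower_central c k = {0}"
    using assms(1) by (auto simp: nilpotent_algebra_def)
  have zero: "lower_central c (k + n) \<subseteq> {0}" for n
  proof (induction n)
    case (Suc n)
    then show ?case
      using lower_central_decreasing[of c "k + n"] by auto
  qed (simp add: k)
  then have "lower_central c m \<subseteq> {0}"
    using zero[of m] const[of k] by (metis add.commute)
  then show ?thesis
    using vec.subspace_0[OF lower_central_subspace, of c m] by blast
qed

lemma Leib_left:
  assumes "c \<in> Leib"
  shows "alg_mult c x (alg_mult c y z) =
    alg_mult c (alg_mult c x y) z - alg_mult c (alg_mult c x z) y"
proof -
  have "alg_mult c (alg_mult c x y) z =
      alg_mult c (alg_mult c x z) y + alg_mult c x (alg_mult c y z)"
    using assms unfolding Leib_def by blast
  then show ?thesis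
    by (simp only: add_diff_cancel_left')
qed

lemma alg_mult_subspace_right:
  assumes "vec.subspace S"
  shows "vec.subspace {y. alg_mult c x y \<in> S}"
  using assms
  by (simp add: vec.subspace_def alg_mult_add_right alg_mult_scale_right)

text \<open>Induction on \<open>j\<close>, writing \<open>x (z w)\<close> as
  \<open>(x z) w - (x w) z\<close>. In the shifted index this is
  \<open>L\<^sup>i L\<^sup>j \<subseteq> L\<^sup>i\<^sup>+\<^sup>j\<close>.\<close>

lemma lower_central_prod:
  assumes "c \<in> Leib"
  shows "x \<in> lower_central c i \<Longrightarrow> y \<in> lower_central c j \<Longrightarrow>
    alg_mult c x y \<in> lower_central c (Suc (i + j))"
proof (induction j arbitrary: i x y)
  case 0
  then show ?case
    using lower_central_mult by simp
next
  case (Suc j)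
  have "lower_central c (Suc j) \<subseteq> {y. alg_mult c x y \<in> lower_central c (Suc (i + Suc j))}"
  proof (intro lower_central_subset alg_mult_subspace_right lower_central_subspace CollectI)
    fix z w
    assume z: "z \<in> lower_central c j"
    have "alg_mult c (alg_mult c x z) w \<in> lower_central c (Suc (i + Suc j))"
      using lower_central_mult[OF Suc.IH[OF Suc.prems(1) z]] by simp
    moreover have "alg_mult c (alg_mult c x w) z \<in> lower_central c (Suc (i + Suc j))"
      using Suc.IH[OF lower_central_mult[OF Suc.prems(1)] z] by simp
    ultimately show "alg_mult c x (alg_mult c z w) \<in> lower_central c (Suc (i + Suc j))"
      unfolding Leib_left[OF assms] by (intro vec.subspace_diff lower_central_subspace)
  qed
  then show ?case
    using Suc.prems(2) by auto
qed

section \<open>Recognising nilpotent algebras in the five families\<close>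

lemma basis4_products_subspace:
  assumes S: "vec.subspace S" and "flag4 a b v u"
    and P: "\<And>x y. x \<in> {a, b, v, u} \<Longrightarrow> y \<in> {a, b, v, u} \<Longrightarrow> alg_mult c x y \<in> S"
  shows "lower_central c 1 \<subseteq> S"
proof -
  have "alg_mult c x y \<in> S" for x y
  proof -
    obtain s1 s2 s3 s4 where x: "x = s1 *s a + s2 *s b + s3 *s v + s4 *s u"
      using flag4_expand[OF assms(2)] by metis
    obtain t1 t2 t3 t4 where y: "y = t1 *s a + t2 *s b + t3 *s v + t4 *s u"
      using flag4_expand[OF assms(2)] by metis
    show ?thesis
      unfolding x y alg_mult_add_left alg_mult_add_right alg_mult_scale_left alg_mult_scale_right
      by (intro vec.subspace_add[OF S] vec.subspace_scale[OF S] P) simp_all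
  qed
  then show ?thesis
    unfolding One_nat_def by (intro lower_central_subset S)
qed

text \<open>Nilpotency forces \<open>u y = 0\<close>, as \<open>u\<close> would otherwise be an
  eigenvector. Then \<open>x (y w) = 0\<close> by the Leibniz identity, so \<open>x u = 0\<close>,
  and the product is a bilinear form on \<open>\<langle>a, b, v\<rangle>\<close> times
  \<open>u\<close>.\<close>

lemma extension_familyI:
  assumes c: "c \<in> Leib" "nilpotent_algebra c" and "u \<noteq> 0" "lower_central c 1 \<subseteq> vec.span {u}"
  shows "c \<in> family (\<lambda>p. structure_of (extension_mult p))"
proof -
  have prod: "alg_mult c x y \<in> lower_central c 1" for x y
    using lower_central_mult[of x c 0 y] by simp
  have left: "alg_mult c u y = 0" for y
  proof -
    obtain t where "alg_mult c u y = t *s u"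
      using prod assms(4) span_singleton_iff by blast
    then show ?thesis
      using not_nilpotent[of c u y t] c(2) assms(3) by auto
  qed
  have left': "alg_mult c z y = 0" if z: "z \<in> lower_central c 1" for z y
  proof -
    obtain t where "z = t *s u"
      using z assms(4) span_singleton_iff by blast
    then show ?thesis
      by (simp add: alg_mult_scale_left left)
  qed
  have right: "alg_mult c x u = 0" for x
  proof (cases "lower_central c 1 \<subseteq> {0}")
    case True
    then show ?thesis
      using prod by blast
  next
    case False
    then obtain z where z: "z \<in> lower_central c 1" "z \<noteq> 0"
      by blast
    obtain t where t: "z = t *s u"
      using z(1) assms(4) span_singleton_iff by blast
    have "lower_central c 1 \<subseteq> {y. alg_mult c x y \<in> {0}}"
      unfolding One_nat_def
    proof (intro lower_central_subset alg_mult_subspace_right CollectI)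
      fix y w
      show "alg_mult c x (alg_mult c y w) \<in> {0}"
        unfolding Leib_left[OF c(1)] by (simp add: left'[OF prod])
    qed simp
    then have "t *s alg_mult c x u = 0"
      using z(1) t by (auto simp: alg_mult_scale_right)
    then show ?thesis
      using z(2) t by auto
  qed
  obtain v where v: "v \<notin> vec.span {u}"
    using ex_notin_span3(3) by blast
  obtain b where b: "b \<notin> vec.span {v, u}"
    using ex_notin_span3(2) by blast
  obtain a where a: "a \<notin> vec.span {b, v, u}"
    using ex_notin_span3(1) by blast
  have flag: "flag4 a b v u"
    using assms(3) a b v by (simp add: flag4_def)
  let ?g = "basis4 a b v u"
  have "\<exists>t. alg_mult c (?g *v axis i 1) (?g *v axis j 1) = t *s u" for i j
    using prod assms(4) span_singleton_iff by blast
  then obtain B where B: "\<forall>i j. alg_mult c (?g *v axis i 1) (?g *v axis j 1) = B i j *s u"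
    by metis
  note B' = B[unfolded forall_4 basis4_axis]
  \<comment> \<open>The zero entries include \<open>p $ 4 $ 4 $ 4\<close>, so this is an undeformed
    member of the family.\<close>
  define p :: "4 structure_constants" where "p = (\<chi> i j k. if i = 4 \<or> j = 4 then 0 else B i j)"
  have "\<forall>i j. alg_mult c (?g *v axis i 1) (?g *v axis j 1) =
      ?g *v extension_mult p (axis i 1) (axis j 1)"
    using B' unfolding forall_4 basis4_axis
    by (simp add: left right basis4_mult extension_mult_def bil_form_def
        kernel_form_def adj_form_def row_form_def col_form_def p_def axis_def)
  then show ?thesis
    by (intro familyI[OF flag extension_mult_Leib(2)]) auto
qed

text \<open>Since \<open>L\<^sup>3 = 0\<close>, both \<open>v\<close> and \<open>u\<close>
  annihilate on either side. Only the four products of \<open>a\<close> and \<open>b\<close> remain,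
  with \<open>t = 0\<close>.\<close>

lemma two_step_familyI:
  assumes c: "c \<in> Leib" and flag: "flag4 a b v u" and L1: "lower_central c 1 \<subseteq> vec.span {v, u}"
    and vu: "v \<in> lower_central c 1" "u \<in> lower_central c 1" and L2: "lower_central c 2 = {0}"
  shows "c \<in> family (\<lambda>p. structure_of (two_step_mult p))"
proof -
  have zero: "alg_mult c x y = 0" "alg_mult c y x = 0" if "x \<in> lower_central c 1" for x y
    using lower_central_mult[OF that, of y] lower_central_prod[OF c, of y 0 x 1] L2 that
    by (simp_all add: numeral_2_eq_2)
  have "\<exists>s t. alg_mult c x y = s *s v + t *s u" for x y
    using lower_central_mult[of x c 0 y] L1 by (auto simp flip: span_pair_iff)
  then obtain S T where ST: "\<And>x y. alg_mult c x y = S x y *s v + T x y *s u"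
    by metis
  define p :: "4 structure_constants" where
    "p = (\<chi> i j. let x = if i = 1 then a else b; y = if j = 1 then a else b
      in if i = 4 then 0 else coords4 0 0 (S x y) (T x y))"
  have "\<forall>i j. alg_mult c (basis4 a b v u *v axis i 1) (basis4 a b v u *v axis j 1) =
      basis4 a b v u *v two_step_mult p (axis i 1) (axis j 1)"
    using ST[of a a] ST[of a b] ST[of b a] ST[of b b] unfolding forall_4 basis4_axis
    by (simp add: zero[OF vu(1)] zero[OF vu(2)] basis4_mult two_step_mult_def p_def axis_def)
  then show ?thesis
    by (intro familyI[OF flag two_step_mult_Leib(2)]) auto
qed

text \<open>Only right multiplication by \<open>a\<close> survives, and its image lies in
  \<open>L\<^sup>2\<close>.\<close>

lemma cyclic_familyI:
  assumes flag: "flag4 a b v u" and L1: "lower_central c 1 \<subseteq> vec.span {b, v, u}"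
    and zero: "\<And>x y. y \<in> {b, v, u} \<Longrightarrow> alg_mult c x y = 0"
  shows "c \<in> family (\<lambda>p. structure_of (cyclic_mult p))"
proof -
  have "\<exists>r s t. alg_mult c x a = r *s b + s *s v + t *s u" for x
    using lower_central_mult[of x c 0 a] L1 by (auto simp flip: span_triple_iff)
  then obtain R S T where RST: "\<And>x. alg_mult c x a = R x *s b + S x *s v + T x *s u"
    by metis
  define p :: "4 structure_constants" where
    "p = (\<chi> i j. let x = basis4 a b v u *v axis i 1 in coords4 0 (R x) (S x) (T x))"
  have "\<forall>i j. alg_mult c (basis4 a b v u *v axis i 1) (basis4 a b v u *v axis j 1) =
      basis4 a b v u *v cyclic_mult p (axis i 1) (axis j 1)"
    using RST[of a] RST[of b] RST[of u] RST[of v] unfolding forall_4 basis4_axis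
    by (simp add: zero cyclic_mult_def p_def basis4_axis sum_4
        basis4_mult[of _ _ _ _ "coords4 _ _ _ _"])
      (simp add: axis_def)
  then show ?thesis
    by (intro familyI[OF flag bilinear_cyclic_mult]) auto
qed

text \<open>Write \<open>x y = S(x, y) v + T(x, y) u\<close>. The Leibniz identity becomes the
  relation \<open>eq\<close> between \<open>S\<close>, \<open>f\<close> and \<open>g\<close>. Either
  \<open>g = 0\<close> and \<open>S\<close> is a product \<open>h(x) f(y)\<close>, or
  \<open>S\<close> is alternating and \<open>g = - f\<close>.\<close>

lemma three_step_familyI:
  assumes c: "c \<in> Leib" and flag: "flag4 a b v u" and L1: "lower_central c 1 \<subseteq> vec.span {v, u}"
    and vu: "v \<in> lower_central c 1" "u \<in> lower_central c 2"
    and L2: "lower_central c 2 \<subseteq> vec.span {u}" and L3: "lower_central c 3 = {0}"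
  shows "c \<in> family (\<lambda>p. structure_of (three_step_mult p)) \<or>
    c \<in> family (\<lambda>p. structure_of (skew_three_step_mult p))"
proof -
  have zero: "alg_mult c u y = 0" "alg_mult c y u = 0" for y
    using lower_central_mult[OF vu(2), of y] lower_central_prod[OF c, of y 0 u 2] L3 vu(2)
    by (simp_all add: numeral_2_eq_2 numeral_3_eq_3)
  have vv: "alg_mult c v v = 0"
    using lower_central_prod[OF c vu(1) vu(1)] L3 by (simp add: numeral_3_eq_3)
  have "\<exists>s t. alg_mult c x y = s *s v + t *s u" for x y
    using lower_central_mult[of x c 0 y] L1 by (auto simp flip: span_pair_iff)
  then obtain S T where ST: "\<And>x y. alg_mult c x y = S x y *s v + T x y *s u"
    by metis
  have "\<exists>t. alg_mult c v x = t *s u" "\<exists>t. alg_mult c x v = t *s u" for x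
    using lower_central_mult[OF vu(1), of x] lower_central_prod[OF c, of x 0 v 1] L2 vu(1)
    by (auto simp: numeral_2_eq_2 simp flip: span_singleton_iff)
  then obtain f g where f: "\<And>x. alg_mult c v x = f x *s u" and g: "\<And>x. alg_mult c x v = g x *s u"
    by metis
  have u: "u \<noteq> 0" and v: "v \<notin> vec.span {u}"
    using flag by (auto simp: flag4_def)
  have eq: "S x y * f z = S x z * f y + S y z * g x" for x y z
  proof -
    have 1: "alg_mult c (alg_mult c x y) z = (S x y * f z) *s u" for x y z
      unfolding ST[of x y] alg_mult_add_left alg_mult_scale_left f zero
      by (simp add: vector_smult_assoc)
    have 2: "alg_mult c x (alg_mult c y z) = (S y z * g x) *s u"
      unfolding ST[of y z] alg_mult_add_right alg_mult_scale_right g zero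
      by (simp add: vector_smult_assoc)
    have "(S x y * f z) *s u = (S x z * f y + S y z * g x) *s u"
      using Leib_left[OF c, of x y z] unfolding 1 2 by (simp add: vec.scale_left_distrib)
    then show ?thesis
      using u vec.scale_cancel_right by blast
  qed
  \<comment> \<open>Otherwise \<open>L\<^sup>2 \<subseteq> \<langle>u\<rangle>\<close>, although
    \<open>v\<close> is in \<open>L\<^sup>2\<close>.\<close>
  have S0: "S a a \<noteq> 0 \<or> S a b \<noteq> 0 \<or> S b a \<noteq> 0 \<or> S b b \<noteq> 0"
  proof (rule ccontr)
    assume "\<not> ?thesis"
    then have *: "alg_mult c a a = T a a *s u" "alg_mult c a b = T a b *s u"
       "alg_mult c b a = T b a *s u" "alg_mult c b b = T b b *s u"
      using ST[of a a] ST[of a b] ST[of b a] ST[of b b] by simp_all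
    have "lower_central c 1 \<subseteq> vec.span {u}"
      by (rule basis4_products_subspace[OF vec.subspace_span flag])
        (auto simp: * f g zero vv vec.span_zero intro!: vec.span_scale[OF vec.span_base])
    then show False
      using v vu(1) by blast
  qed
  \<comment> \<open>Otherwise \<open>L\<^sup>3 = 0\<close>, although \<open>u\<close> is in
    \<open>L\<^sup>3\<close>.\<close>
  have fg: "f a \<noteq> 0 \<or> f b \<noteq> 0 \<or> g a \<noteq> 0 \<or> g b \<noteq> 0"
  proof (rule ccontr)
    assume "\<not> ?thesis"
    then have *: "alg_mult c v a = 0" "alg_mult c v b = 0" "alg_mult c a v = 0" "alg_mult c b v = 0"
      by (simp_all add: f g)
    have "lower_central c 2 \<subseteq> {0}"
      unfolding numeral_2_eq_2
    proof (rule lower_central_subset)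
      fix x y
      assume "x \<in> lower_central c (Suc 0)"
      then have "x \<in> vec.span {v, u}"
        using L1 by auto
      then obtain s t where x: "x = s *s v + t *s u"
        unfolding span_pair_iff by (elim exE)
      obtain t1 t2 t3 t4 where y: "y = t1 *s a + t2 *s b + t3 *s v + t4 *s u"
        using flag4_expand[OF flag] by metis
      show "alg_mult c x y \<in> {0}"
        unfolding x y alg_mult_add_left alg_mult_add_right alg_mult_scale_left alg_mult_scale_right
        by (simp add: * zero vv)
    qed simp
    then show False
      using u vu(2) by blast
  qed
  show ?thesis
  proof (cases "g a = 0 \<and> g b = 0")
    case True
    then obtain z where z: "z \<in> {a, b}" "f z \<noteq> 0"
      using fg by auto
    \<comment> \<open>For \<open>g x = 0\<close>, \<open>eq\<close> reads
      \<open>S x y * f z = S x z * f y\<close>; dividing by \<open>f z\<close> exhibits the rank one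
      form.\<close>
    define h where "h x = S x z / f z" for x
    have h: "S x y = h x * f y" if "x \<in> {a, b}" for x y
      using eq[of x y z] True z(2) that by (auto simp: h_def field_simps)
    define p :: "4 structure_constants" where
      "p = (\<chi> i j k. if i = 4 then 0 else if j = 4 then h (if i = 1 then a else b)
        else if i = 3 then f (if j = 1 then a else b)
        else T (if i = 1 then a else b) (if j = 1 then a else b))"
    have "\<forall>i j. alg_mult c (basis4 a b v u *v axis i 1) (basis4 a b v u *v axis j 1) =
        basis4 a b v u *v three_step_mult p (axis i 1) (axis j 1)"
      using ST[of a a] ST[of a b] ST[of b a] ST[of b b] f[of a] f[of b] g[of a] g[of b] True
      unfolding forall_4 basis4_axis
      by (simp add: zero vv h basis4_mult three_step_mult_def p_def axis_def)
    then have "c \<in> family (\<lambda>p. structure_of (three_step_mult p))"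
      by (intro familyI[OF flag bilinear_three_step_mult]) auto
    then show ?thesis ..
  next
    case False
    \<comment> \<open>The four instances of \<open>eq\<close> give
      \<open>S a a * g a = S a a * g b = 0\<close>, and likewise for \<open>S b b\<close>.\<close>
    then have diag: "S a a = 0" "S b b = 0"
      using eq[of a a a] eq[of a b b] eq[of b a a] eq[of b b b] by auto
    note e = eq[of a a b] eq[of a b a] eq[of b a b] eq[of b b a]
    \<comment> \<open>With zero diagonal, \<open>e\<close> amounts to
      \<open>S a b * (f a + g a) = 0\<close>, \<open>S a b * f a = S b a * g a\<close> and the same
      with \<open>a\<close> and \<open>b\<close> exchanged.\<close>
    have anti: "S b a = - S a b" "g a = - f a" "g b = - f b"
      using e diag S0 False fg by algebra+
    define p :: "4 structure_constants" where
      "p = (\<chi> i j k. if i = 4 then 0 else if k = 3 then S a b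
        else if i = 3 then f (if j = 1 then a else b)
        else T (if i = 1 then a else b) (if j = 1 then a else b))"
    have "\<forall>i j. alg_mult c (basis4 a b v u *v axis i 1) (basis4 a b v u *v axis j 1) =
        basis4 a b v u *v skew_three_step_mult p (axis i 1) (axis j 1)"
      using ST[of a a] ST[of a b] ST[of b a] ST[of b b] f[of a] f[of b] g[of a] g[of b]
      unfolding forall_4 basis4_axis
      by (simp add: zero vv diag anti basis4_mult skew_three_step_mult_def p_def axis_def)
    then have "c \<in> family (\<lambda>p. structure_of (skew_three_step_mult p))"
      by (intro familyI[OF flag bilinear_skew_three_step_mult]) auto
    then show ?thesis ..
  qed
qed

text \<open>
  The right annihilator \<open>R\<close> is an ideal containing \<open>a a\<close>, so \<open>L\<^sup>2 \<subseteq> R + L\<^sup>3\<close>. Iterating,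
  \<open>L\<^sup>2 \<subseteq> R + L\<^sup>k\<close> for all \<open>k\<close>, and nilpotency gives \<open>L\<^sup>2 \<subseteq> R\<close>.
\<close>

lemma lower_central_1_right_annihilator:
  assumes c: "c \<in> Leib" "nilpotent_algebra c"
    and gen: "\<And>x. \<exists>s. \<exists>y\<in>lower_central c 1. x = s *s a + y"
    and y: "y \<in> lower_central c 1"
  shows "alg_mult c x y = 0"
proof -
  define R where "R = {y. \<forall>x. alg_mult c x y = 0}"
  \<comment> \<open>This is \<open>R + L\<^sup>k\<^sup>+\<^sup>1\<close>, because of the shifted
    index.\<close>
  define T where "T k = {y. \<exists>r\<in>R. y - r \<in> lower_central c k}" for k
  have R0: "0 \<in> R" and R_add: "\<And>r s. r \<in> R \<Longrightarrow> s \<in> R \<Longrightarrow> r + s \<in> R"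
    and R_scale: "\<And>t r. r \<in> R \<Longrightarrow> t *s r \<in> R"
    by (simp_all add: R_def alg_mult_add_right alg_mult_scale_right)
  have RI: "r \<in> T k" if "r \<in> R" for r k
    unfolding T_def mem_Collect_eq
    by (rule bexI[OF _ that]) (simp add: vec.subspace_0[OF lower_central_subspace])
  have T: "vec.subspace (T k)" for k
  proof (rule vec.subspaceI)
    show "0 \<in> T k"
      by (rule RI[OF R0])
    show "x + y \<in> T k" if xy: "x \<in> T k" "y \<in> T k" for x y
    proof -
      obtain r s where rs: "r \<in> R" "s \<in> R" "x - r \<in> lower_central c k" "y - s \<in> lower_central c k"
        using xy by (auto simp: T_def)
      have "(x - r) + (y - s) \<in> lower_central c k"
        by (rule vec.subspace_add[OF lower_central_subspace rs(3,4)])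
      then show ?thesis
        unfolding T_def mem_Collect_eq
        by (intro bexI[OF _ R_add[OF rs(1,2)]]) (simp add: algebra_simps)
    qed
    show "t *s x \<in> T k" if x: "x \<in> T k" for t x
    proof -
      obtain r where r: "r \<in> R" "x - r \<in> lower_central c k"
        using x by (auto simp: T_def)
      have "t *s (x - r) \<in> lower_central c k"
        by (rule vec.subspace_scale[OF lower_central_subspace r(2)])
      then show ?thesis
        unfolding T_def mem_Collect_eq
        by (intro bexI[OF _ R_scale[OF r(1)]]) (simp only: vec.scale_right_diff_distrib)
    qed
  qed
  have R_mult: "alg_mult c r y \<in> R" if "r \<in> R" for r y
    using that by (simp add: R_def Leib_left[OF c(1)])
  \<comment> \<open>\<open>x (a a) = (x a) a - (x a) a\<close>.\<close>
  have aa: "alg_mult c a a \<in> R"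
    by (simp add: R_def Leib_left[OF c(1)])
  have sub: "lower_central c 1 \<subseteq> T (Suc k)" for k
  proof (induction k)
    case 0
    show ?case
      unfolding T_def by (intro subsetI CollectI bexI[OF _ R0]) simp
  next
    case (Suc k)
    \<comment> \<open>Multiplying an element of \<open>R + L\<^sup>k\<^sup>+\<^sup>2\<close> on the
      right leaves the first summand in \<open>R\<close> and moves the second one term down.\<close>
    have L2: "lower_central c 2 \<subseteq> T (Suc (Suc k))"
      unfolding numeral_2_eq_2
    proof (rule lower_central_subset[OF T])
      fix x y
      assume "x \<in> lower_central c (Suc 0)"
      then have "x \<in> T (Suc k)"
        using Suc.IH by auto
      then obtain r where r: "r \<in> R" "x - r \<in> lower_central c (Suc k)"
        by (auto simp: T_def)
      have "alg_mult c x y = alg_mult c r y + alg_mult c (x - r) y"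
        by (simp flip: alg_mult_add_left)
      then have "alg_mult c x y - alg_mult c r y \<in> lower_central c (Suc (Suc k))"
        using lower_central_mult[OF r(2)] by simp
      then show "alg_mult c x y \<in> T (Suc (Suc k))"
        using R_mult[OF r(1)] by (auto simp: T_def)
    qed
    \<comment> \<open>Modulo \<open>L\<^sup>3\<close>, every product is a multiple of
      \<open>a a\<close>, which is in \<open>R\<close>.\<close>
    have "lower_central c (Suc 0) \<subseteq> T (Suc (Suc k))"
    proof (rule lower_central_subset[OF T])
      fix x y
      assume "x \<in> lower_central c 0"
      obtain s x' where x: "x' \<in> lower_central c 1" "x = s *s a + x'"
        using gen by blast
      obtain t y' where y: "y' \<in> lower_central c 1" "y = t *s a + y'"
        using gen by blast
      have "alg_mult c x' y \<in> T (Suc (Suc k))"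
        using lower_central_mult[OF x(1), of y] L2 by (auto simp: numeral_2_eq_2)
      moreover have "alg_mult c a y' \<in> T (Suc (Suc k))"
        using lower_central_prod[OF c(1), of a 0 y' 1] y(1) L2 by (auto simp: numeral_2_eq_2)
      moreover have "alg_mult c x y = s *s alg_mult c a y + alg_mult c x' y"
        unfolding x(2) alg_mult_add_left alg_mult_scale_left ..
      moreover have "alg_mult c a y = t *s alg_mult c a a + alg_mult c a y'"
        unfolding y(2) alg_mult_add_right alg_mult_scale_right ..
      ultimately show "alg_mult c x y \<in> T (Suc (Suc k))"
        by (simp only:) (intro vec.subspace_add[OF T] vec.subspace_scale[OF T] RI[OF aa])
    qed
    then show ?case
      by simp
  qed
  obtain k where k: "lower_central c k = {0}"
    using c(2) by (auto simp: nilpotent_algebra_def)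
  then have "lower_central c (Suc k) \<subseteq> {0}"
    using lower_central_decreasing[of c k] by simp
  moreover obtain r where r: "r \<in> R" "y - r \<in> lower_central c (Suc k)"
    using y sub[of k] unfolding T_def by blast
  ultimately have "y = r"
    by auto
  then show ?thesis
    using r(1) by (simp add: R_def)
qed

text \<open>Case distinction on \<open>dim L\<^sup>2\<close>, with \<open>L\<^sup>3\<close> zero or
  not when it is 2. Nonzero terms of the series decrease strictly, which bounds the dimensions of
  the later ones.\<close>

lemma nilpotent_in_families:
  fixes c :: "4 structure_constants"
  assumes c: "c \<in> Leib" "nilpotent_algebra c"
  shows "c \<in> (\<Union>m\<in>{cyclic_mult, extension_mult, two_step_mult, three_step_mult,
    skew_three_step_mult}. family (\<lambda>p. structure_of (m p)))"
proof (cases "\<exists>u. u \<noteq> 0 \<and> lower_central c 1 \<subseteq> vec.span {u}")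
  case True
  then show ?thesis
    using extension_familyI[OF c] by blast
next
  case False
  have dec: "lower_central c 2 \<subseteq> lower_central c 1" "lower_central c 3 \<subseteq> lower_central c 2"
    using lower_central_decreasing[of c 1] lower_central_decreasing[of c 2]
    by (simp_all add: numeral_2_eq_2 numeral_3_eq_3)
  have stat: "lower_central c 1 = lower_central c 0 \<Longrightarrow> lower_central c 0 = {0}"
    "lower_central c 2 = lower_central c 1 \<Longrightarrow> lower_central c 1 = {0}"
    "lower_central c 3 = lower_central c 2 \<Longrightarrow> lower_central c 2 = {0}"
    using lower_central_stationary[OF c(2), of 0] lower_central_stationary[OF c(2), of 1]
      lower_central_stationary[OF c(2), of 2]
    by (simp_all add: numeral_2_eq_2 numeral_3_eq_3)
  have zero: "0 \<in> lower_central c m" for m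
    by (rule vec.subspace_0[OF lower_central_subspace])
  have span: "vec.span S \<subseteq> lower_central c m" if "S \<subseteq> lower_central c m" for S m
    by (rule vec.span_minimal[OF that lower_central_subspace])
  have "\<not> lower_central c 1 \<subseteq> {0}"
  proof
    assume "lower_central c 1 \<subseteq> {0}"
    then have "lower_central c 1 \<subseteq> vec.span {axis 1 1}"
      using vec.span_zero by blast
    moreover have "axis 1 1 \<noteq> (0 :: complex ^ 4)"
      by simp
    ultimately show False
      using False by blast
  qed
  \<comment> \<open>\<open>u\<close> is taken in \<open>L\<^sup>3\<close> whenever that is nonzero,
    so that one flag serves both subcases of \<open>dim L\<^sup>2 = 2\<close>.\<close>
  then obtain u where u: "u \<noteq> 0" "u \<in> lower_central c 1"
      "lower_central c 2 = {0} \<or> u \<in> lower_central c 2"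
    using dec(1) zero[of 2] by blast
  obtain v where v: "v \<in> lower_central c 1" "v \<notin> vec.span {u}"
    using False u(1) by blast
  show ?thesis
  proof (cases "lower_central c 1 \<subseteq> vec.span {v, u}")
    case True
    obtain b where b: "b \<notin> vec.span {v, u}"
      using ex_notin_span3(2) by blast
    obtain a where "a \<notin> vec.span {b, v, u}"
      using ex_notin_span3(1) by blast
    then have flag: "flag4 a b v u"
      using u v b by (simp add: flag4_def)
    show ?thesis
    proof (cases "lower_central c 2 = {0}")
      case L2: True
      show ?thesis
        using two_step_familyI[OF c(1) flag True v(1) u(2) L2] by blast
    next
      case L2: False
      then have u2: "u \<in> lower_central c 2"
        using u(3) by blast
      \<comment> \<open>An element of \<open>L\<^sup>3\<close> involving \<open>v\<close> would put
        \<open>v\<close> into \<open>L\<^sup>3\<close>, making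
        \<open>L\<^sup>3 = L\<^sup>2\<close>.\<close>
      have span2: "lower_central c 2 \<subseteq> vec.span {u}"
      proof
        fix x
        assume x: "x \<in> lower_central c 2"
        then obtain s t where st: "x = s *s v + t *s u"
          using True dec(1) span_pair_iff[of x v u] by blast
        show "x \<in> vec.span {u}"
        proof (cases "s = 0")
          case True
          then show ?thesis
            using st by (auto simp: span_singleton_iff)
        next
          case False
          have "x - t *s u \<in> lower_central c 2"
            by (intro vec.subspace_diff vec.subspace_scale lower_central_subspace x u2)
          then have "inverse s *s (s *s v) \<in> lower_central c 2"
            unfolding st
            by (simp only: add_diff_cancel_right' vec.subspace_scale[OF lower_central_subspace])
          then have "v \<in> lower_central c 2"
            using False by (simp add: vector_smult_assoc)
          then have "lower_central c 1 \<subseteq> lower_central c 2"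
            using True span[of "{v, u}" 2] u2 by blast
          then show ?thesis
            using dec(1) stat(2) u(1,2) by blast
        qed
      qed
      \<comment> \<open>A nonzero element would be a multiple of \<open>u\<close>, giving
        \<open>L\<^sup>4 = L\<^sup>3\<close>.\<close>
      have "lower_central c 3 = {0}"
      proof (rule ccontr)
        assume "lower_central c 3 \<noteq> {0}"
        then obtain x where x: "x \<in> lower_central c 3" "x \<noteq> 0"
          using zero[of 3] by blast
        then obtain t where t: "x = t *s u"
          using dec(2) span2 span_singleton_iff by blast
        have "inverse t *s x \<in> lower_central c 3"
          by (rule vec.subspace_scale[OF lower_central_subspace x(1)])
        then have "u \<in> lower_central c 3"
          using t x(2) by (auto simp: vector_smult_assoc)
        then have "lower_central c 2 \<subseteq> lower_central c 3"
          using span2 span[of "{u}" 3] by blast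
        then show False
          using dec(2) stat(3) L2 by blast
      qed
      then show ?thesis
        using three_step_familyI[OF c(1) flag True v(1) u2 span2] by blast
    qed
  next
    case False
    then obtain w where w: "w \<in> lower_central c 1" "w \<notin> vec.span {v, u}"
      by blast
    obtain a where a: "a \<notin> vec.span {w, v, u}"
      using ex_notin_span3(1) by blast
    have flag: "flag4 x w v u" if "x \<notin> vec.span {w, v, u}" for x
      using that u v w by (simp add: flag4_def)
    have comb: "r *s w + s *s v + t *s u \<in> lower_central c 1" for r s t
      by (intro vec.subspace_add vec.subspace_scale lower_central_subspace u v w)
    \<comment> \<open>A fourth independent vector would make \<open>L\<^sup>2\<close> the whole
      algebra.\<close>
    have L1: "lower_central c 1 \<subseteq> vec.span {w, v, u}"
    proof (rule ccontr)
      assume "\<not> ?thesis"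
      then obtain x where x: "x \<in> lower_central c 1" "x \<notin> vec.span {w, v, u}"
        by blast
      have "y \<in> lower_central c 1" for y
      proof -
        obtain q r s t where "y = q *s x + r *s w + s *s v + t *s u"
          using flag4_expand[OF flag[OF x(2)]] by metis
        then have "y = q *s x + (r *s w + s *s v + t *s u)"
          by (simp add: add_ac)
        then show ?thesis
          using x(1) comb by (simp only: vec.subspace_add[OF lower_central_subspace]
            vec.subspace_scale[OF lower_central_subspace])
      qed
      then have "lower_central c 1 = lower_central c 0"
        by auto
      then show False
        using stat(1) u(1) by auto
    qed
    have gen: "\<exists>s. \<exists>y\<in>lower_central c 1. x = s *s a + y" for x
    proof -
      obtain q r s t where "x = q *s a + r *s w + s *s v + t *s u"
        using flag4_expand[OF flag[OF a]] by metis
      then have "x = q *s a + (r *s w + s *s v + t *s u)"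
        by (simp add: add_ac)
      then show ?thesis
        using comb by blast
    qed
    have "c \<in> family (\<lambda>p. structure_of (cyclic_mult p))"
      using u(2) v(1) w(1)
      by (intro cyclic_familyI[OF flag[OF a] L1] lower_central_1_right_annihilator[OF c gen]) auto
    then show ?thesis
      by blast
  qed
qed

theorem lemma3:
  fixes C :: "4 structure_constants set"
  assumes "irreducible_component_of (subtopology zariski Leib) C"
  shows "\<exists>c\<in>C. \<not> nilpotent_algebra c"
proof (rule ccontr)
  assume nil: "\<not> ?thesis"
  let ?\<N> = "(\<lambda>m p. structure_of (m p)) `
    {cyclic_mult, extension_mult, two_step_mult, three_step_mult, skew_three_step_mult}"
  have "closedin (subtopology zariski Leib) C"
    using assms unfolding irreducible_component_of_def by (elim conjE)
  then have C: "C \<subseteq> Leib"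
    by (simp add: closedin_Leib)
  have cover: "C \<subseteq> (\<Union>N\<in>?\<N>. family N)"
  proof
    fix c
    assume "c \<in> C"
    then have "c \<in> Leib" "nilpotent_algebra c"
      using C nil by blast+
    then show "c \<in> (\<Union>N\<in>?\<N>. family N)"
      using nilpotent_in_families by fastforce
  qed
  have "\<exists>N\<in>?\<N>. family N \<subseteq> C"
  proof (rule component_in_family[OF assms _ cover])
    show "finite ?\<N>"
      by simp
    show "polynomial_fun (\<lambda>p. N p $ i $ j $ k)" if "N \<in> ?\<N>" for N i j k
      using that polynomial_families by auto
    show "N p \<in> Leib" if "N \<in> ?\<N>" for N p
      using that cyclic_mult_Leib extension_mult_Leib(1) two_step_mult_Leib(1)
        three_step_mult_Leib skew_three_step_mult_Leib by auto
  qed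
  moreover have "\<exists>p. \<not> nilpotent_algebra (N p)" if "N \<in> ?\<N>" for N
    using that non_nilpotent_examples by auto
  moreover have "N p \<in> family N" for N p
    unfolding family_def mem_Collect_eq
    by (intro exI[of _ "mat 1"] exI[of _ p]) simp
  ultimately show False
    using nil by blast
qed

end
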